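(* Let $(S_n)_{n\ge0}$ be positively divergent and $\mathbb{P}\{\xi<0\}>0$. Then the following assertions are equivalent for any $a>0$: (1) $\mathbb{E}e^{aZ(t)}<\infty$ for some $t\in\mathbb{R}$; (2) $\mathbb{E}e^{aZ(t)}<\infty$ for all $t\in\mathbb{R}$; (3) $r^{>}(t)<\infty$ for all $t\in\mathbb{R}$; (4) $r^{>}(t)<\infty$ for some $t\in\mathbb{R}$; where $$l(t):=\mathbb{E}\Big(\prod_{n=1}^{\tau^*}e^{aX_n(t-S_{n-1})}\Big)\quad\text{and}\quad r^{>}(t):=\int\big(l(t-u)-1\big)\,\mathbb{U}^{>}(du),\qquad t\in\mathbb{R}.$$ Furthermore, these conditions imply $r(t)<\infty$ and $l(t)<\infty$ for all $t\in\mathbb{R}$, where $r(t):=\int\big(\mathbb{E}e^{aX(t-y)}-1\big)\,\mathbb{U}(dy)$.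
   Context: Let $\xi$ be a real-valued random variable with $\mathbb{P}\{\xi=0\}<1$ and let $(X(t))_{t\in\mathbb{R}}$ be a nonnegative (finite-valued) stochastic process with nondecreasing paths such that $\lim_{t\to-\infty}X(t)=0$ a.s. Any dependence between $(X(t))_{t\in\mathbb{R}}$ and $\xi$ is allowed. Let $((X_n(t))_{t\in\mathbb{R}},\xi_n)_{n\ge1}$ be a sequence of independent copies of $((X(t))_{t\in\mathbb{R}},\xi)$. Put $S_0:=0$, $S_n:=\xi_1+\cdots+\xi_n$ for $n\in\mathbb{N}$, and define the renewal shot-noise process $Z(t):=\sum_{n\ge1}X_n(t-S_{n-1})$, $t\in\mathbb{R}$. The random walk $(S_n)_{n\ge0}$ is positively divergent if $\lim_{n\to\infty}S_n=\infty$ a.s. Let $\tau_0^*:=0$ and $\tau_n^*:=\inf\{k>\tau_{n-1}^*:S_k>S_{\tau_{n-1}^*}\}$ for $n\ge1$ be the strictly ascending ladder epochs, $\tau^*:=\tau_1^*=\inf\{n\ge1:S_n>0\}$. Let $\mathbb{U}:=\sum_{n\ge0}\mathbb{P}\{S_n\in\cdot\}$ and let $\mathbb{U}^{>}:=\sum_{n\ge0}\mathbb{P}\{S_{\tau_n^*}\in\cdot\}$ be the renewal measure of the strictly ascending ladder heights. *)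

theory Defs
  imports "HOL-Probability.Probability" "HOL-Library.Extended_Nat"
begin

definition ennexp :: "ennreal \<Rightarrow> ennreal" where
  "ennexp x = (if x = \<top> then \<top> else ennreal (exp (enn2real x)))"

definition nonneg_nondecreasing_process :: "'w measure \<Rightarrow> (real \<Rightarrow> 'w \<Rightarrow> real) \<Rightarrow> bool" where
  "nonneg_nondecreasing_process M X \<longleftrightarrow>
     (\<forall>t. X t \<in> borel_measurable M) \<and>
     (\<forall>\<omega>\<in>space M. (\<forall>t. 0 \<le> X t \<omega>) \<and> mono (\<lambda>t. X t \<omega>))"

text \<open>The state space of a pair (process, real random variable), where the process is viewed
  as a random element of the space of all real functions with the product sigma-algebra.\<close>

definition pair_space :: "((real \<Rightarrow> real) \<times> real) measure" where
  "pair_space = (\<Pi>\<^sub>M t\<in>UNIV. borel) \<Otimes>\<^sub>M borel"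

text \<open>Monotonicity of paths is not an event of the product sigma-algebra, so equality in law
  alone does not transfer it; that the copies are again nonnegative processes with nondecreasing
  paths is therefore part of the definition.  Copies are numbered from 1;
  the values at index 0 are irrelevant.\<close>

definition independent_copies ::
  "'w measure \<Rightarrow> (real \<Rightarrow> 'w \<Rightarrow> real) \<Rightarrow> ('w \<Rightarrow> real) \<Rightarrow>
   (nat \<Rightarrow> real \<Rightarrow> 'w \<Rightarrow> real) \<Rightarrow> (nat \<Rightarrow> 'w \<Rightarrow> real) \<Rightarrow> bool" where
  "independent_copies M X \<xi> Xs \<xi>s \<longleftrightarrow>
     (\<forall>n\<ge>1. nonneg_nondecreasing_process M (Xs n)) \<and>
     prob_space.indep_vars M (\<lambda>_. pair_space) (\<lambda>n \<omega>. (\<lambda>t. Xs n t \<omega>, \<xi>s n \<omega>)) {1..} \<and>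
     (\<forall>n\<ge>1. distr M pair_space (\<lambda>\<omega>. (\<lambda>t. Xs n t \<omega>, \<xi>s n \<omega>)) =
             distr M pair_space (\<lambda>\<omega>. (\<lambda>t. X t \<omega>, \<xi> \<omega>)))"

definition walk :: "(nat \<Rightarrow> 'w \<Rightarrow> real) \<Rightarrow> nat \<Rightarrow> 'w \<Rightarrow> real" where
  "walk \<xi>s n \<omega> = (\<Sum>k=1..n. \<xi>s k \<omega>)"

definition positively_divergent :: "'w measure \<Rightarrow> (nat \<Rightarrow> 'w \<Rightarrow> real) \<Rightarrow> bool" where
  "positively_divergent M S \<longleftrightarrow> (AE \<omega> in M. filterlim (\<lambda>n. S n \<omega>) at_top sequentially)"

text \<open>The summand at \<open>n\<close> here is the one at \<open>n + 1\<close> in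
  \<open>\<Sum>n\<ge>1. X\<^sub>n (t - S\<^sub>n\<^sub>-\<^sub>1)\<close>; the sum may be infinite.\<close>

definition shot_noise ::
  "(nat \<Rightarrow> real \<Rightarrow> 'w \<Rightarrow> real) \<Rightarrow> (nat \<Rightarrow> 'w \<Rightarrow> real) \<Rightarrow> real \<Rightarrow> 'w \<Rightarrow> ennreal" where
  "shot_noise Xs \<xi>s t \<omega> = (\<Sum>n. ennreal (Xs (Suc n) (t - walk \<xi>s n \<omega>) \<omega>))"

text \<open>Strictly ascending ladder epochs of a single path \<open>s\<close>; the infimum of the empty set
  is \<open>\<infinity>\<close>, and all epochs after an infinite one are infinite.\<close>

fun ladder_epoch :: "(nat \<Rightarrow> real) \<Rightarrow> nat \<Rightarrow> enat" where
  "ladder_epoch s 0 = 0"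
| "ladder_epoch s (Suc n) =
     (case ladder_epoch s n of
        enat m \<Rightarrow> Inf (enat ` {k. k > m \<and> s k > s m})
      | \<infinity> \<Rightarrow> \<infinity>)"

definition renewal_measure :: "'w measure \<Rightarrow> (nat \<Rightarrow> 'w \<Rightarrow> real) \<Rightarrow> real measure" where
  "renewal_measure M S =
     measure_of UNIV (sets borel) (\<lambda>B. \<Sum>n. emeasure M {\<omega>\<in>space M. S n \<omega> \<in> B})"

text \<open>The \<open>n\<close>-th ladder height only contributes where the \<open>n\<close>-th ladder epoch is finite.\<close>

definition ladder_renewal_measure :: "'w measure \<Rightarrow> (nat \<Rightarrow> 'w \<Rightarrow> real) \<Rightarrow> real measure" where
  "ladder_renewal_measure M S =
     measure_of UNIV (sets borel) (\<lambda>B. \<Sum>n. emeasure M {\<omega>\<in>space M.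
       \<exists>m. ladder_epoch (\<lambda>k. S k \<omega>) n = enat m \<and> S m \<omega> \<in> B})"

definition shot_noise_exp_moment ::
  "'w measure \<Rightarrow> (nat \<Rightarrow> real \<Rightarrow> 'w \<Rightarrow> real) \<Rightarrow> (nat \<Rightarrow> 'w \<Rightarrow> real) \<Rightarrow> real \<Rightarrow> real \<Rightarrow> ennreal" where
  "shot_noise_exp_moment M Xs \<xi>s a t = (\<integral>\<^sup>+\<omega>. ennexp (ennreal a * shot_noise Xs \<xi>s t \<omega>) \<partial>M)"

text \<open>The expected product up to the first ladder epoch.  All factors are at least 1, so on the
  event that the epoch is infinite (a null event for a positively divergent walk) the infinite
  product is the supremum of the partial products.\<close>

definition ladder_product_mean ::
  "'w measure \<Rightarrow> (nat \<Rightarrow> real \<Rightarrow> 'w \<Rightarrow> real) \<Rightarrow> (nat \<Rightarrow> 'w \<Rightarrow> real) \<Rightarrow> real \<Rightarrow> real \<Rightarrow> ennreal" where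
  "ladder_product_mean M Xs \<xi>s a t =
     (\<integral>\<^sup>+\<omega>. (let P = (\<lambda>m. \<Prod>n=1..m. ennreal (exp (a * Xs n (t - walk \<xi>s (n - 1) \<omega>) \<omega>)))
            in case ladder_epoch (\<lambda>k. walk \<xi>s k \<omega>) 1 of
                 enat m \<Rightarrow> P m
               | \<infinity> \<Rightarrow> (SUP m. P m)) \<partial>M)"

text \<open>Since \<open>l \<ge> 1\<close> and \<open>E exp (a X(t)) \<ge> 1\<close>, the truncated subtraction of
  extended nonnegative reals is the ordinary one in the next two definitions.\<close>

definition r_ladder ::
  "'w measure \<Rightarrow> (nat \<Rightarrow> real \<Rightarrow> 'w \<Rightarrow> real) \<Rightarrow> (nat \<Rightarrow> 'w \<Rightarrow> real) \<Rightarrow> real \<Rightarrow> real \<Rightarrow> ennreal" where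
  "r_ladder M Xs \<xi>s a t =
     (\<integral>\<^sup>+u. (ladder_product_mean M Xs \<xi>s a (t - u) - 1) \<partial>ladder_renewal_measure M (walk \<xi>s))"

definition r_walk ::
  "'w measure \<Rightarrow> (real \<Rightarrow> 'w \<Rightarrow> real) \<Rightarrow> (nat \<Rightarrow> 'w \<Rightarrow> real) \<Rightarrow> real \<Rightarrow> real \<Rightarrow> ennreal" where
  "r_walk M X \<xi>s a t =
     (\<integral>\<^sup>+y. ((\<integral>\<^sup>+\<omega>. ennreal (exp (a * X (t - y) \<omega>)) \<partial>M) - 1) \<partial>renewal_measure M (walk \<xi>s))"

end

theory Submission
  imports Defs
begin

text \<open>Cut the walk at its strict ladder epochs.  By the strong Markov property, the excess
  \<open>u(t) = E exp (a Z(t)) - 1\<close> satisfies \<open>u \<ge> h + K u\<close> with \<open>h = l - 1\<close> and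
  \<open>K f (t) = E f (t - S\<^sub>\<tau>)\<close>, whose minimal solution is \<open>r\<^sup>> = \<Sum> K\<^sup>n h\<close>; hence \<open>r\<^sup>> \<le> u\<close>.
  Conversely, ladder heights are positive and everything is monotone in \<open>t\<close>, so the exponential
  moments \<open>\<psi>\<^sub>n\<close> of the partial sums satisfy \<open>\<psi>\<^sub>n\<^sub>+\<^sub>1 \<le> h \<psi>\<^sub>n + K \<psi>\<^sub>n\<close>, which yields
  \<open>\<psi>\<^sub>n(t) \<le> 1 / (1 - r\<^sup>>(t))\<close> whenever \<open>r\<^sup>>(t) < 1\<close>.  Dominated convergence gives
  \<open>r\<^sup>>(t) \<rightarrow> 0\<close> as \<open>t \<rightarrow> -\<infinity>\<close>.  Since the walk may start with a step below \<open>-\<delta>\<close>, finiteness of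
  \<open>u\<close> or \<open>r\<^sup>>\<close> at \<open>t\<close> implies finiteness at \<open>t + \<delta>\<close>, hence everywhere.  Because of
  this shift invariance, \<open>exp (a X(s))\<close> may be replaced by a jointly measurable quantity between
  \<open>exp (a X(s))\<close> and \<open>exp (a X(s + 1))\<close>.\<close>

section \<open>Ladder epochs\<close>

text \<open>A nonempty infimum of naturals is attained, so a finite value is a condition on
  positions up to \<open>j\<close> alone. Measurability and the stopping-time property are read off
  from this form.\<close>

lemma ladder_epoch_Suc_eq_enat_iff:
  "ladder_epoch s (Suc n) = enat j \<longleftrightarrow>
    (\<exists>m<j. ladder_epoch s n = enat m \<and> s m < s j \<and> (\<forall>k. m < k \<longrightarrow> k < j \<longrightarrow> s k \<le> s m))"
proof (cases "ladder_epoch s n")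
  case (enat m)
  let ?A = "{k. m < k \<and> s m < s k}"
  have "Inf (enat ` ?A) = enat j \<longleftrightarrow> j \<in> ?A \<and> (\<forall>k\<in>?A. j \<le> k)"
  proof
    assume eq: "Inf (enat ` ?A) = enat j"
    have "enat ` ?A \<noteq> {}"
    proof
      assume "enat ` ?A = {}"
      then have "Inf (enat ` ?A) = \<infinity>"
        by (simp only: Inf_empty top_enat_def)
      with eq show False by simp
    qed
    then have "Inf (enat ` ?A) \<in> enat ` ?A"
      unfolding Inf_enat_def by (auto intro: LeastI)
    moreover have "enat j \<le> enat k" if "k \<in> ?A" for k
      unfolding eq[symmetric] using that by (intro Inf_lower) auto
    ultimately show "j \<in> ?A \<and> (\<forall>k\<in>?A. j \<le> k)"
      unfolding eq by auto
  next
    assume "j \<in> ?A \<and> (\<forall>k\<in>?A. j \<le> k)"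
    then show "Inf (enat ` ?A) = enat j"
      by (intro antisym Inf_lower Inf_greatest) auto
  qed
  also have "\<dots> \<longleftrightarrow> m < j \<and> s m < s j \<and> (\<forall>k. m < k \<longrightarrow> k < j \<longrightarrow> s k \<le> s m)"
    by (auto simp: not_less[symmetric])
  finally show ?thesis
    using enat by auto
qed simp

lemma ladder_epoch_Suc_0_eq_enat_iff:
  "ladder_epoch s (Suc 0) = enat j \<longleftrightarrow> 0 < j \<and> s 0 < s j \<and> (\<forall>k. 0 < k \<longrightarrow> k < j \<longrightarrow> s k \<le> s 0)"
  unfolding ladder_epoch_Suc_eq_enat_iff by (auto simp: zero_enat_def)

lemma ladder_epoch_Suc_0_le:
  assumes "0 < k" "s 0 < s k"
  obtains j where "ladder_epoch s (Suc 0) = enat j" "j \<le> k"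
proof -
  have "ladder_epoch s (Suc 0) \<le> enat k"
    using assms by (auto simp: zero_enat_def intro!: Inf_lower)
  with that show thesis
    by (metis enat_ile enat_ord_simps(1))
qed

text \<open>The characterization of a finite epoch inspects no later position. This is the
  stopping-time property behind the strong Markov argument.\<close>

lemma ladder_epoch_eq_enat_cong:
  assumes "\<And>k. k \<le> m \<Longrightarrow> s k = s' k"
  shows "ladder_epoch s n = enat m \<longleftrightarrow> ladder_epoch s' n = enat m"
  using assms
proof (induction n arbitrary: m)
  case (Suc n)
  have "ladder_epoch s n = enat i \<longleftrightarrow> ladder_epoch s' n = enat i" if "i < m" for i
    using that Suc.prems by (intro Suc.IH) auto
  then show ?case
    unfolding ladder_epoch_Suc_eq_enat_iff using Suc.prems by (auto cong: conj_cong)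
qed simp

text \<open>Regeneration: records after a finite epoch are records of the re-centred path. The two
  sides attain the same finite values, hence they are also infinite together.\<close>

lemma ladder_epoch_Suc_eq_add:
  assumes "ladder_epoch s n = enat m"
  shows "ladder_epoch s (Suc n) = enat m + ladder_epoch (\<lambda>k. s (m + k) - s m) (Suc 0)"
proof -
  have *: "ladder_epoch s (Suc n) = enat (m + j) \<longleftrightarrow>
      ladder_epoch (\<lambda>k. s (m + k) - s m) (Suc 0) = enat j" for j
  proof -
    have "(\<forall>k. m < k \<longrightarrow> k < m + j \<longrightarrow> s k \<le> s m) \<longleftrightarrow> (\<forall>k. 0 < k \<longrightarrow> k < j \<longrightarrow> s (m + k) \<le> s m)"
      by (metis add_less_cancel_left less_add_same_cancel1 less_imp_add_positive)
    then show ?thesis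
      unfolding ladder_epoch_Suc_0_eq_enat_iff ladder_epoch_Suc_eq_enat_iff[of s] using assms by simp
  qed
  show ?thesis
  proof (cases "ladder_epoch s (Suc n)")
    case (enat i)
    then have "m < i"
      using assms unfolding ladder_epoch_Suc_eq_enat_iff by auto
    then show ?thesis
      using *[of "i - m"] enat by auto
  next
    case infinity
    then show ?thesis
      using * by (cases "ladder_epoch (\<lambda>k. s (m + k) - s m) (Suc 0)") auto
  qed
qed

lemma ladder_epoch_Suc_eq_infinity:
  "ladder_epoch s n = \<infinity> \<Longrightarrow> ladder_epoch s (Suc n) = \<infinity>"
  by simp

declare ladder_epoch.simps(2) [simp del]

section \<open>Extended nonnegative reals and measures\<close>

text \<open>Splits a quantity over the value of an epoch. The sum gives measurability and
  interchange with integrals; the case form, where an infinite epoch counts 0, serves pathwise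
  reasoning.\<close>

lemma suminf_enat_eq:
  fixes f :: "nat \<Rightarrow> ennreal"
  shows "(\<Sum>m. if e = enat m then f m else 0) = (case e of enat m \<Rightarrow> f m | \<infinity> \<Rightarrow> 0)"
proof (cases e)
  case (enat i)
  have "(\<Sum>m. if i = m then f m else 0) = (\<Sum>m\<in>{i}. if i = m then f m else 0)"
    by (rule suminf_finite) auto
  then show ?thesis using enat by simp
qed simp

text \<open>Expanding a product of terms \<open>1 + x\<close> and dropping the mixed terms leaves
  the sum. This is what bounds \<open>r\<close> by the exponential moment.\<close>

lemma one_add_sum_le_prod_ennreal:
  fixes f :: "nat \<Rightarrow> ennreal"
  assumes "\<And>n. 1 \<le> f n"
  shows "1 + (\<Sum>n<N. f n - 1) \<le> (\<Prod>n<N. f n)"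
proof (induction N)
  case (Suc N)
  define x where "x = f N - 1"
  have x: "f N = 1 + x"
    using assms[of N] unfolding x_def by (metis add.commute diff_add_cancel_ennreal)
  have "1 + (\<Sum>n<Suc N. f n - 1) = (1 + (\<Sum>n<N. f n - 1)) + 1 * x"
    by (simp add: x_def ac_simps)
  also have "\<dots> \<le> (\<Prod>n<N. f n) + (\<Prod>n<N. f n) * x"
    using Suc by (intro add_mono mult_right_mono) (auto intro!: prod_ge_1 assms intro: order_trans[OF _ Suc])
  also have "\<dots> = (\<Prod>n<Suc N. f n)"
    by (simp add: x distrib_left)
  finally show ?case .
qed simp

lemma ennreal_mult_diff_1:
  fixes x y :: ennreal
  assumes "1 \<le> x"
  shows "x * y = (x - 1) * y + y"
proof -
  have "x * y = (x - 1 + 1) * y"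
    using assms by (simp add: diff_add_cancel_ennreal)
  then show ?thesis by (simp add: distrib_right)
qed

text \<open>A set function given to \<open>measure_of\<close> yields a measure with these values
  only if it is countably additive. Here this follows from a genuine measure with the same values:
  the image under \<open>V\<close> of counting measure times \<open>M\<close>, restricted to
  \<open>A\<close>.\<close>

lemma nn_integral_sum_of_laws:
  fixes f :: "real \<Rightarrow> ennreal" and V :: "nat \<Rightarrow> 'w \<Rightarrow> real"
  assumes "sigma_finite_measure M"
    and [measurable]: "\<And>n. Measurable.pred M (A n)" "\<And>n. V n \<in> borel_measurable M"
      "f \<in> borel_measurable borel"
  shows "(\<integral>\<^sup>+u. f u \<partial>measure_of UNIV (sets borel)
      (\<lambda>B. \<Sum>n. emeasure M {\<omega> \<in> space M. A n \<omega> \<and> V n \<omega> \<in> B}))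
    = (\<Sum>n. \<integral>\<^sup>+\<omega>. (if A n \<omega> then f (V n \<omega>) else 0) \<partial>M)"
proof -
  interpret sigma_finite_measure M by fact
  let ?C = "count_space (UNIV :: nat set) \<Otimes>\<^sub>M M"
  have [measurable]: "(\<lambda>(n, \<omega>). V n \<omega>) \<in> borel_measurable ?C"
    by (intro measurable_pair_measure_countable1) auto
  have [measurable]: "Measurable.pred ?C (\<lambda>(n, \<omega>). A n \<omega>)"
    by (intro measurable_pair_measure_countable1) auto
  define D where "D = distr (density ?C (\<lambda>(n, \<omega>). if A n \<omega> then 1 else 0)) borel (\<lambda>(n, \<omega>). V n \<omega>)"
  have D: "(\<integral>\<^sup>+u. h u \<partial>D) = (\<Sum>n. \<integral>\<^sup>+\<omega>. (if A n \<omega> then h (V n \<omega>) else 0) \<partial>M)"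
    if [measurable]: "h \<in> borel_measurable borel" for h :: "real \<Rightarrow> ennreal"
  proof -
    have "(\<integral>\<^sup>+u. h u \<partial>D) = (\<integral>\<^sup>+(n, \<omega>). (if A n \<omega> then h (V n \<omega>) else 0) \<partial>?C)"
      unfolding D_def by (subst nn_integral_distr, simp, simp, subst nn_integral_density)
        (auto intro!: nn_integral_cong split: if_splits)
    also have "\<dots> = (\<integral>\<^sup>+n. (\<integral>\<^sup>+\<omega>. (if A n \<omega> then h (V n \<omega>) else 0) \<partial>M) \<partial>count_space UNIV)"
      by (subst nn_integral_fst[symmetric]) auto
    finally show ?thesis
      by (simp add: nn_integral_count_space_nat)
  qed
  have "emeasure D B = (\<Sum>n. emeasure M {\<omega> \<in> space M. A n \<omega> \<and> V n \<omega> \<in> B})"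
    if [measurable]: "B \<in> sets borel" for B
  proof -
    have "emeasure D B = (\<integral>\<^sup>+u. indicator B u \<partial>D)"
      by (simp add: D_def)
    also have "\<dots> = (\<Sum>n. \<integral>\<^sup>+\<omega>. indicator {\<omega> \<in> space M. A n \<omega> \<and> V n \<omega> \<in> B} \<omega> \<partial>M)"
      by (subst D, simp, intro suminf_cong nn_integral_cong) (auto simp: indicator_def)
    finally show ?thesis
      by simp
  qed
  then have "measure_of UNIV (sets borel) (\<lambda>B. \<Sum>n. emeasure M {\<omega> \<in> space M. A n \<omega> \<and> V n \<omega> \<in> B})
      = measure_of UNIV (sets borel) (emeasure D)"
    by (intro measure_of_eq) (auto simp: sets.sigma_sets_eq[of borel, simplified])
  also have "\<dots> = D"
    using measure_of_of_measure[of D] by (simp add: D_def)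
  finally show ?thesis
    using D[of f] by simp
qed

text \<open>The partial products are exponentials of the partial sums; they converge by continuity
  and increase, so the limit is the supremum. A divergent sum is treated apart because
  \<open>ennexp\<close> sets its value at \<open>\<top>\<close> separately.\<close>

lemma ennexp_suminf:
  fixes x :: "nat \<Rightarrow> real"
  assumes "\<And>n. 0 \<le> x n" "0 < a"
  shows "ennexp (ennreal a * (\<Sum>n. ennreal (x n))) = (SUP m. \<Prod>n<m. ennreal (exp (a * x n)))"
proof -
  define s where "s m = (\<Sum>n<m. x n)" for m
  have prod: "(\<Prod>n<m. ennreal (exp (a * x n))) = ennreal (exp (a * s m))" for m
    by (simp add: prod_ennreal exp_sum s_def sum_distrib_left)
  have s: "(\<lambda>m. ennreal (s m)) \<longlonglongrightarrow> (\<Sum>n. ennreal (x n))"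
  proof -
    have "ennreal (s m) = (\<Sum>n<m. ennreal (x n))" for m
      unfolding s_def using assms by (subst sum_ennreal) auto
    then show ?thesis
      by (simp add: summable_LIMSEQ)
  qed
  have "(\<lambda>m. ennreal (exp (a * s m))) \<longlonglongrightarrow> ennexp (ennreal a * (\<Sum>n. ennreal (x n)))"
  proof (cases "\<Sum>n. ennreal (x n)")
    case (real l)
    then have "s \<longlonglongrightarrow> l"
      using s assms unfolding real(2)
      by (subst (asm) tendsto_ennreal_iff) (auto simp: s_def intro!: always_eventually sum_nonneg)
    then have "(\<lambda>m. ennreal (exp (a * s m))) \<longlonglongrightarrow> ennreal (exp (a * l))"
      by (intro tendsto_intros)
    then show ?thesis
      using real assms by (simp add: ennexp_def ennreal_mult[symmetric])
  next
    case top
    then have "filterlim s at_top sequentially"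
      using s by (simp add: ennreal_tendsto_top_eq_at_top)
    then have "filterlim (\<lambda>m. exp (a * s m)) at_top sequentially"
      using assms
      by (intro filterlim_compose[OF exp_at_top] filterlim_tendsto_pos_mult_at_top[OF tendsto_const])
    then show ?thesis
      using top assms by (simp add: ennexp_def ennreal_mult_top ennreal_tendsto_top_eq_at_top)
  qed
  moreover have "incseq (\<lambda>m. ennreal (exp (a * s m)))"
    using assms by (intro incseq_SucI ennreal_leI) (simp add: s_def)
  ultimately show ?thesis
    unfolding prod using LIMSEQ_SUP LIMSEQ_unique by blast
qed

section \<open>A jointly measurable majorant\<close>

text \<open>A process with monotone paths need not be jointly measurable, so \<open>X (t - S)\<close> need not be
  measurable for random \<open>S\<close>.  The following majorant is, as it depends on countably many
  coordinates only.\<close>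

definition upper_factor :: "real \<Rightarrow> real \<Rightarrow> (real \<Rightarrow> real) \<times> real \<Rightarrow> ennreal" where
  "upper_factor a s e = (INF q\<in>\<rat>. if s < q then ennreal (exp (a * max 0 (fst e q))) else \<top>)"

text \<open>The truncation by \<open>max 0\<close> secures this at every point of the pair space,
  not only at nonnegative paths.\<close>

lemma one_le_upper_factor: "0 < a \<Longrightarrow> 1 \<le> upper_factor a s e"
  unfolding upper_factor_def by (intro INF_greatest) auto

text \<open>Raising \<open>s\<close> turns some candidates of the infimum into \<open>\<top>\<close>
  and changes no other, so this holds for every \<open>e\<close>, monotone path or not.\<close>

lemma upper_factor_mono: "s \<le> t \<Longrightarrow> upper_factor a s e \<le> upper_factor a t e"
  unfolding upper_factor_def by (intro INF_mono') auto

text \<open>Encoding the constraint \<open>s < q\<close> by the value \<open>\<top>\<close> keeps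
  the countable index set of the infimum independent of \<open>s\<close>.\<close>

lemma measurable_upper_factor:
  "(\<lambda>(s, e). upper_factor a s e) \<in> borel_measurable (borel \<Otimes>\<^sub>M pair_space)"
  unfolding upper_factor_def pair_space_def split_beta'
  by (intro borel_measurable_INF countable_rat) measurable

lemma measurable_upper_factor_at [measurable]: "upper_factor a s \<in> borel_measurable pair_space"
  unfolding upper_factor_def pair_space_def by (intro borel_measurable_INF countable_rat) measurable

lemma le_upper_factor:
  assumes "mono x" "\<And>t. 0 \<le> x t" "0 < a"
  shows "ennreal (exp (a * x s)) \<le> upper_factor a s (x, y)"
  unfolding upper_factor_def using assms
  by (intro INF_greatest) (auto intro!: ennreal_leI mult_left_mono monoD[OF assms(1)])

text \<open>A rational strictly between \<open>s\<close> and \<open>s + 1\<close> is a candidate for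
  the infimum. With the preceding lemma, the majorant is exact up to a unit time shift.\<close>

lemma upper_factor_le:
  assumes "mono x" "\<And>t. 0 \<le> x t" "0 < a"
  shows "upper_factor a s (x, y) \<le> ennreal (exp (a * x (s + 1)))"
proof -
  obtain q where q: "q \<in> \<rat>" "s < q" "q < s + 1"
    using Rats_dense_in_real[of s "s + 1"] by auto
  then have "upper_factor a s (x, y) \<le> ennreal (exp (a * max 0 (x q)))"
    unfolding upper_factor_def by (intro INF_lower2[of q]) auto
  also have "\<dots> \<le> ennreal (exp (a * x (s + 1)))"
    using assms q by (auto intro!: ennreal_leI mult_left_mono monoD[OF assms(1)])
  finally show ?thesis .
qed

section \<open>Multiplicative functionals of a random walk\<close>

text \<open>\<open>sequence_space\<close> supplies the product measure \<open>S\<close>, under which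
  the coordinates are independent with law \<open>N\<close>; coordinate \<open>k\<close> stands for
  the pair of step \<open>k + 1\<close>. The function \<open>g\<close> abstracts the
  majorant.\<close>

locale shot_noise_walk = sequence_space N for N :: "'e measure" +
  fixes \<xi> :: "'e \<Rightarrow> real" and g :: "real \<Rightarrow> 'e \<Rightarrow> ennreal"
  assumes measurable_xi [measurable]: "\<xi> \<in> borel_measurable N"
    and measurable_g: "(\<lambda>(s, e). g s e) \<in> borel_measurable (borel \<Otimes>\<^sub>M N)"
    and one_le_g: "1 \<le> g s e"
    and g_mono: "s \<le> s' \<Longrightarrow> g s e \<le> g s' e"
    and g_lim: "AE e in N. (INF k. g (- real k) e) = 1"
    and xi_neg: "emeasure N {e \<in> space N. \<xi> e < 0} > 0"
    and ladder_finite: "AE w in S. \<exists>n>0. 0 < (\<Sum>k<n. \<xi> (w k))"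
begin

definition pos :: "(nat \<Rightarrow> 'e) \<Rightarrow> nat \<Rightarrow> real" where
  "pos w n = (\<Sum>k<n. \<xi> (w k))"

definition shift :: "nat \<Rightarrow> (nat \<Rightarrow> 'e) \<Rightarrow> nat \<Rightarrow> 'e" where
  "shift m w k = w (m + k)"

text \<open>As coordinates count from 0, this is the factor of copy \<open>n + 1\<close>, read at
  \<open>t - S_n\<close>.\<close>

definition factor :: "real \<Rightarrow> (nat \<Rightarrow> 'e) \<Rightarrow> nat \<Rightarrow> ennreal" where
  "factor t w n = g (t - pos w n) (w n)"

definition partial_product :: "real \<Rightarrow> (nat \<Rightarrow> 'e) \<Rightarrow> nat \<Rightarrow> ennreal" where
  "partial_product t w n = (\<Prod>k<n. factor t w k)"

definition full_product :: "real \<Rightarrow> (nat \<Rightarrow> 'e) \<Rightarrow> ennreal" where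
  "full_product t w = (SUP n. partial_product t w n)"

definition ladder_product :: "real \<Rightarrow> (nat \<Rightarrow> 'e) \<Rightarrow> ennreal" where
  "ladder_product t w = (case ladder_epoch (pos w) (Suc 0) of
     enat m \<Rightarrow> partial_product t w m | \<infinity> \<Rightarrow> full_product t w)"

definition at_ladder :: "nat \<Rightarrow> (real \<Rightarrow> ennreal) \<Rightarrow> (nat \<Rightarrow> 'e) \<Rightarrow> ennreal" where
  "at_ladder n f w = (case ladder_epoch (pos w) n of enat m \<Rightarrow> f (pos w m) | \<infinity> \<Rightarrow> 0)"

text \<open>This is \<open>K^n\<close> of the overview, defined through the \<open>n\<close>-th
  ladder height rather than by iteration, so that summing over \<open>n\<close> gives an integral
  against the ladder renewal measure. The power laws follow from the strong Markov property.\<close>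

definition ladder_kernel :: "nat \<Rightarrow> (real \<Rightarrow> ennreal) \<Rightarrow> real \<Rightarrow> ennreal" where
  "ladder_kernel n f t = (\<integral>\<^sup>+w. at_ladder n (\<lambda>u. f (t - u)) w \<partial>S)"

definition ladder_excess :: "real \<Rightarrow> ennreal" where
  "ladder_excess t = (\<integral>\<^sup>+w. (ladder_product t w - 1) \<partial>S)"

definition total_excess :: "real \<Rightarrow> ennreal" where
  "total_excess t = (\<integral>\<^sup>+w. (full_product t w - 1) \<partial>S)"

definition ladder_potential :: "real \<Rightarrow> ennreal" where
  "ladder_potential t = (\<Sum>n. ladder_kernel n ladder_excess t)"

section \<open>Path identities and monotonicity in time\<close>

lemma pos_0 [simp]: "pos w 0 = 0"
  by (simp add: pos_def)

lemma pos_add: "pos w (m + k) = pos w m + pos (shift m w) k"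
  unfolding pos_def shift_def lessThan_atLeast0
  by (simp add: sum.atLeastLessThan_concat[of 0 m "m + k", symmetric]
      sum.atLeastLessThan_shift_0[of _ m])

lemma factor_add: "factor t w (m + k) = factor (t - pos w m) (shift m w) k"
  unfolding factor_def pos_add by (simp add: shift_def algebra_simps)

lemma one_le_factor: "1 \<le> factor t w n"
  by (simp add: factor_def one_le_g)

lemma factor_mono: "s \<le> t \<Longrightarrow> factor s w n \<le> factor t w n"
  by (simp add: factor_def g_mono)

lemma one_le_partial_product: "1 \<le> partial_product t w n"
  unfolding partial_product_def by (intro prod_ge_1 one_le_factor)

text \<open>Cocycle property: after \<open>m\<close> steps the product restarts from the shifted
  sequence at time \<open>t - S_m\<close>. Every decomposition at a ladder epoch rests on
  it.\<close>

lemma partial_product_add: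
  "partial_product t w (m + k) = partial_product t w m * partial_product (t - pos w m) (shift m w) k"
  unfolding partial_product_def lessThan_atLeast0
  by (simp add: prod.atLeastLessThan_concat[of 0 m "m + k", symmetric]
      prod.atLeastLessThan_shift_0[of _ m] factor_add)

lemma partial_product_le: "m \<le> n \<Longrightarrow> partial_product t w m \<le> partial_product t w n"
  using mult_mono[OF order_refl one_le_partial_product, of "partial_product t w m"]
  by (auto simp: le_iff_add partial_product_add)

lemma partial_product_mono: "s \<le> t \<Longrightarrow> partial_product s w n \<le> partial_product t w n"
  unfolding partial_product_def by (induction n) (auto intro!: mult_mono factor_mono)

lemma one_le_full_product: "1 \<le> full_product t w"
  unfolding full_product_def
  using one_le_partial_product[of t w 0] SUP_upper[of 0 UNIV "partial_product t w"] by auto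

lemma partial_product_le_full: "partial_product t w n \<le> full_product t w"
  unfolding full_product_def by (rule SUP_upper) simp

lemma full_product_mono: "s \<le> t \<Longrightarrow> full_product s w \<le> full_product t w"
  unfolding full_product_def by (intro SUP_mono') (rule partial_product_mono)

text \<open>Partial products increase, so the supremum may start at index \<open>m\<close>; then the
  cocycle property factors out the first block.\<close>

lemma full_product_split:
  "full_product t w = partial_product t w m * full_product (t - pos w m) (shift m w)"
proof -
  have "full_product t w = (SUP n. partial_product t w (m + n))"
    unfolding full_product_def
  proof (intro antisym SUP_mono)
    show "\<exists>i\<in>UNIV. partial_product t w n \<le> partial_product t w (m + i)" for n
      by (intro bexI[of _ n] partial_product_le) auto
  qed auto
  then show ?thesis
    by (simp add: partial_product_add full_product_def SUP_mult_left_ennreal)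
qed

lemma one_le_ladder_product: "1 \<le> ladder_product t w"
  unfolding ladder_product_def
  by (auto split: enat.split intro: one_le_full_product one_le_partial_product)

lemma ladder_product_le_full: "ladder_product t w \<le> full_product t w"
  unfolding ladder_product_def by (auto split: enat.split intro: partial_product_le_full)

lemma ladder_product_mono: "s \<le> t \<Longrightarrow> ladder_product s w \<le> ladder_product t w"
  unfolding ladder_product_def
  by (auto split: enat.split intro: partial_product_mono full_product_mono)

lemma ladder_excess_mono: "s \<le> t \<Longrightarrow> ladder_excess s \<le> ladder_excess t"
  unfolding ladder_excess_def by (intro nn_integral_mono ennreal_minus_mono ladder_product_mono) auto

lemma total_excess_mono: "s \<le> t \<Longrightarrow> total_excess s \<le> total_excess t"
  unfolding total_excess_def by (intro nn_integral_mono ennreal_minus_mono full_product_mono) auto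

lemma ladder_kernel_mono:
  "(\<And>s s'. s \<le> s' \<Longrightarrow> f s \<le> f s') \<Longrightarrow> s \<le> t \<Longrightarrow> ladder_kernel n f s \<le> ladder_kernel n f t"
  unfolding ladder_kernel_def at_ladder_def by (intro nn_integral_mono) (auto split: enat.split)

lemma ladder_potential_mono: "s \<le> t \<Longrightarrow> ladder_potential s \<le> ladder_potential t"
  unfolding ladder_potential_def
  by (intro suminf_le ladder_kernel_mono ladder_excess_mono) auto

section \<open>Measurability of the path functionals\<close>

lemma measurable_comp_g [measurable (raw)]:
  assumes "f \<in> borel_measurable Q" "h \<in> Q \<rightarrow>\<^sub>M N"
  shows "(\<lambda>x. g (f x) (h x)) \<in> borel_measurable Q"
  using measurable_compose[OF measurable_Pair[OF assms] measurable_g] by simp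

lemma measurable_pos [measurable (raw)]:
  assumes [measurable]: "h \<in> Q \<rightarrow>\<^sub>M S"
  shows "(\<lambda>x. pos (h x) n) \<in> borel_measurable Q"
  unfolding pos_def by measurable

lemma measurable_shift [measurable]: "shift m \<in> S \<rightarrow>\<^sub>M S"
  unfolding shift_def by (intro measurable_PiM_single') (auto simp: space_PiM)

lemma measurable_partial_product [measurable (raw)]:
  assumes [measurable]: "f \<in> borel_measurable Q" "h \<in> Q \<rightarrow>\<^sub>M S"
  shows "(\<lambda>x. partial_product (f x) (h x) n) \<in> borel_measurable Q"
  unfolding partial_product_def factor_def by measurable

lemma measurable_full_product [measurable (raw)]:
  assumes [measurable]: "f \<in> borel_measurable Q" "h \<in> Q \<rightarrow>\<^sub>M S"
  shows "(\<lambda>x. full_product (f x) (h x)) \<in> borel_measurable Q"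
  unfolding full_product_def by measurable

lemma measurable_ladder_epoch [measurable (raw)]:
  assumes [measurable]: "h \<in> Q \<rightarrow>\<^sub>M S"
  shows "Measurable.pred Q (\<lambda>x. ladder_epoch (pos (h x)) n = enat m)"
proof (induction n arbitrary: m)
  case (Suc n)
  note [measurable] = Suc
  show ?case
    unfolding ladder_epoch_Suc_eq_enat_iff by measurable
qed simp

lemma measurable_ladder_product [measurable (raw)]:
  assumes [measurable]: "f \<in> borel_measurable Q" "h \<in> Q \<rightarrow>\<^sub>M S"
  shows "(\<lambda>x. ladder_product (f x) (h x)) \<in> borel_measurable Q"
proof -
  \<comment> \<open>As a countable sum over the value of the epoch, measurability reduces to the
    events that the epoch equals \<open>m\<close>.\<close>
  have "ladder_product t w = (if \<exists>m. ladder_epoch (pos w) (Suc 0) = enat m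
      then \<Sum>m. if ladder_epoch (pos w) (Suc 0) = enat m then partial_product t w m else 0
      else full_product t w)" for t w
    unfolding ladder_product_def suminf_enat_eq by (auto split: enat.split)
  then show ?thesis
    by simp
qed

lemma measurable_at_ladder [measurable (raw)]:
  assumes [measurable]: "h \<in> Q \<rightarrow>\<^sub>M S" "(\<lambda>(x, u). f x u) \<in> borel_measurable (Q \<Otimes>\<^sub>M borel)"
  shows "(\<lambda>x. at_ladder n (f x) (h x)) \<in> borel_measurable Q"
  unfolding at_ladder_def suminf_enat_eq[symmetric] by measurable

lemma measurable_ladder_kernel [measurable]:
  assumes [measurable]: "f \<in> borel_measurable borel"
  shows "ladder_kernel n f \<in> borel_measurable borel"
  unfolding ladder_kernel_def by measurable

lemma measurable_ladder_excess [measurable]: "ladder_excess \<in> borel_measurable borel"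
  unfolding ladder_excess_def by measurable

lemma measurable_total_excess [measurable]: "total_excess \<in> borel_measurable borel"
  unfolding total_excess_def by measurable

lemma measurable_ladder_potential [measurable]: "ladder_potential \<in> borel_measurable borel"
  unfolding ladder_potential_def by measurable

section \<open>Markov and strong Markov properties\<close>

text \<open>\<open>comb_seq m w w'\<close> continues the first \<open>m\<close> coordinates of
  \<open>w\<close> by \<open>w'\<close>, and glueing two independent sequences reproduces
  \<open>S\<close>. As \<open>A\<close> sees only the first block and the shift only the second,
  Fubini finishes.\<close>

lemma markov:
  assumes [measurable]: "A \<in> borel_measurable S"
      "(\<lambda>(x, w). H x w) \<in> borel_measurable (borel \<Otimes>\<^sub>M S)"
    and adapted: "\<And>w w'. A (comb_seq m w w') = A w"
  shows "(\<integral>\<^sup>+w. A w * H (pos w m) (shift m w) \<partial>S) = (\<integral>\<^sup>+w. A w * (\<integral>\<^sup>+w'. H (pos w m) w' \<partial>S) \<partial>S)"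
proof -
  have pos: "pos (comb_seq m w w') m = pos w m" for w w'
    by (simp add: pos_def comb_seq_def)
  have shift: "shift m (comb_seq m w w') = w'" for w w'
    by (auto simp: shift_def comb_seq_def)
  have "(\<integral>\<^sup>+w. A w * H (pos w m) (shift m w) \<partial>S) =
      (\<integral>\<^sup>+w. A w * H (pos w m) (shift m w) \<partial>distr (S \<Otimes>\<^sub>M S) S (\<lambda>(w, w'). comb_seq m w w'))"
    unfolding PiM_comb_seq ..
  also have "\<dots> = (\<integral>\<^sup>+(w, w'). A w * H (pos w m) w' \<partial>(S \<Otimes>\<^sub>M S))"
    by (subst nn_integral_distr) (auto simp: adapted pos shift intro!: nn_integral_cong)
  also have "\<dots> = (\<integral>\<^sup>+w. (\<integral>\<^sup>+w'. A w * H (pos w m) w' \<partial>S) \<partial>S)"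
    by (subst P.nn_integral_fst[symmetric]) auto
  also have "\<dots> = (\<integral>\<^sup>+w. A w * (\<integral>\<^sup>+w'. H (pos w m) w' \<partial>S) \<partial>S)"
    by (intro nn_integral_cong nn_integral_cmult) simp
  finally show ?thesis .
qed

lemma ladder_epoch_comb_seq:
  "ladder_epoch (pos (comb_seq m w w')) n = enat m \<longleftrightarrow> ladder_epoch (pos w) n = enat m"
  by (intro ladder_epoch_eq_enat_cong) (simp add: pos_def comb_seq_def)

text \<open>Sum over the possible values \<open>m\<close> of the epoch and apply the Markov property
  at each fixed \<open>m\<close>; the event that the epoch is \<open>m\<close> belongs to the first
  \<open>m\<close> steps.\<close>

lemma strong_markov:
  assumes [measurable]: "\<And>m. A m \<in> borel_measurable S"
      "(\<lambda>(x, w). H x w) \<in> borel_measurable (borel \<Otimes>\<^sub>M S)"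
    and adapted: "\<And>m w w'. A m (comb_seq m w w') = A m w"
  shows "(\<integral>\<^sup>+w. (case ladder_epoch (pos w) n of enat m \<Rightarrow> A m w * H (pos w m) (shift m w) | \<infinity> \<Rightarrow> 0) \<partial>S)
    = (\<integral>\<^sup>+w. (case ladder_epoch (pos w) n of
          enat m \<Rightarrow> A m w * (\<integral>\<^sup>+w'. H (pos w m) w' \<partial>S) | \<infinity> \<Rightarrow> 0) \<partial>S)"
proof -
  define B where "B m w = (if ladder_epoch (pos w) n = enat m then A m w else 0)" for m w
  have [measurable]: "B m \<in> borel_measurable S" for m
    unfolding B_def by measurable
  have "(\<integral>\<^sup>+w. B m w * H (pos w m) (shift m w) \<partial>S)
      = (\<integral>\<^sup>+w. B m w * (\<integral>\<^sup>+w'. H (pos w m) w' \<partial>S) \<partial>S)" for m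
    by (intro markov) (auto simp: B_def ladder_epoch_comb_seq adapted)
  then have "(\<integral>\<^sup>+w. (\<Sum>m. B m w * H (pos w m) (shift m w)) \<partial>S)
      = (\<integral>\<^sup>+w. (\<Sum>m. B m w * (\<integral>\<^sup>+w'. H (pos w m) w' \<partial>S)) \<partial>S)"
    by (simp add: nn_integral_suminf)
  moreover have "(\<Sum>m. B m w * C m) = (case ladder_epoch (pos w) n of
      enat m \<Rightarrow> A m w * C m | \<infinity> \<Rightarrow> 0)" for w and C :: "nat \<Rightarrow> ennreal"
    unfolding suminf_enat_eq[symmetric] B_def by (intro suminf_cong) auto
  ultimately show ?thesis
    by simp
qed

section \<open>Powers of the ladder kernel\<close>

lemma ladder_kernel_0: "ladder_kernel 0 f t = f t"
  by (simp add: ladder_kernel_def at_ladder_def zero_enat_def emeasure_space_1)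

text \<open>Regeneration at the \<open>n\<close>-th epoch: the next height is the old one plus the
  first height of the shifted sequence. The factor 1 matches the form of
  \<open>strong_markov\<close>.\<close>

lemma at_ladder_Suc:
  "at_ladder (Suc n) f w = (case ladder_epoch (pos w) n of
     enat m \<Rightarrow> 1 * at_ladder (Suc 0) (\<lambda>u. f (pos w m + u)) (shift m w) | \<infinity> \<Rightarrow> 0)"
proof (cases "ladder_epoch (pos w) n")
  case (enat m)
  have "(\<lambda>k. pos w (m + k) - pos w m) = pos (shift m w)"
    by (simp add: pos_add)
  then have "ladder_epoch (pos w) (Suc n) = enat m + ladder_epoch (pos (shift m w)) (Suc 0)"
    using ladder_epoch_Suc_eq_add[OF enat] by simp
  then show ?thesis
    unfolding at_ladder_def using enat
    by (cases "ladder_epoch (pos (shift m w)) (Suc 0)") (auto simp: pos_add)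
qed (simp add: at_ladder_def ladder_epoch_Suc_eq_infinity)

lemma ladder_kernel_Suc:
  assumes [measurable]: "f \<in> borel_measurable borel"
  shows "ladder_kernel (Suc n) f t = ladder_kernel n (ladder_kernel (Suc 0) f) t"
proof -
  have "ladder_kernel (Suc n) f t = (\<integral>\<^sup>+w. (case ladder_epoch (pos w) n of
      enat m \<Rightarrow> 1 * (\<integral>\<^sup>+w'. at_ladder (Suc 0) (\<lambda>u. f (t - (pos w m + u))) w' \<partial>S) | \<infinity> \<Rightarrow> 0) \<partial>S)"
    unfolding ladder_kernel_def at_ladder_Suc[of n] by (intro strong_markov) auto
  also have "\<dots> = ladder_kernel n (ladder_kernel (Suc 0) f) t"
    unfolding ladder_kernel_def at_ladder_def[of n] diff_diff_eq mult_1 by (rule refl)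
  finally show ?thesis .
qed

text \<open>The strong Markov property gives \<open>K^n\<close> applied after \<open>K\<close>; the
  renewal equation needs \<open>K\<close> outermost, which follows by induction.\<close>

lemma ladder_kernel_Suc':
  assumes [measurable]: "f \<in> borel_measurable borel"
  shows "ladder_kernel (Suc n) f t = ladder_kernel (Suc 0) (ladder_kernel n f) t"
  using assms
proof (induction n arbitrary: f t)
  case 0
  then show ?case
    by (simp add: ladder_kernel_0[abs_def])
next
  case (Suc n)
  note [measurable] = Suc.prems
  have "ladder_kernel (Suc (Suc n)) f t = ladder_kernel (Suc 0) (ladder_kernel n (ladder_kernel (Suc 0) f)) t"
    by (subst ladder_kernel_Suc) (auto intro: Suc.IH)
  also have "ladder_kernel n (ladder_kernel (Suc 0) f) = ladder_kernel (Suc n) f"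
    by (rule ext) (simp add: ladder_kernel_Suc)
  finally show ?case .
qed

lemma ladder_kernel_suminf:
  assumes [measurable]: "\<And>i. f i \<in> borel_measurable borel"
  shows "ladder_kernel n (\<lambda>t. \<Sum>i. f i t) t = (\<Sum>i. ladder_kernel n (f i) t)"
proof -
  have *: "at_ladder n (\<lambda>u. \<Sum>i. f i (t - u)) = (\<lambda>w. \<Sum>i. at_ladder n (\<lambda>u. f i (t - u)) w)"
    unfolding at_ladder_def by (auto split: enat.split)
  show ?thesis
    unfolding ladder_kernel_def * by (simp add: nn_integral_suminf)
qed

lemma ladder_kernel_add:
  assumes [measurable]: "f \<in> borel_measurable borel" "f' \<in> borel_measurable borel"
  shows "ladder_kernel n (\<lambda>t. f t + f' t) t = ladder_kernel n f t + ladder_kernel n f' t"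
proof -
  have *: "at_ladder n (\<lambda>u. f (t - u) + f' (t - u)) =
      (\<lambda>w. at_ladder n (\<lambda>u. f (t - u)) w + at_ladder n (\<lambda>u. f' (t - u)) w)"
    unfolding at_ladder_def by (auto split: enat.split)
  show ?thesis
    unfolding ladder_kernel_def * by (simp add: nn_integral_add)
qed

lemma ladder_kernel_le:
  assumes "\<And>u. f u \<le> f' u"
  shows "ladder_kernel n f t \<le> ladder_kernel n f' t"
  unfolding ladder_kernel_def at_ladder_def using assms
  by (intro nn_integral_mono) (auto split: enat.split)

section \<open>Renewal equation and lower bound for the exponential moment\<close>

text \<open>Separate the term \<open>n = 0\<close> of the series and pull one \<open>K\<close> out
  of the others.\<close>

lemma ladder_potential_eq:
  "ladder_potential t = ladder_excess t + ladder_kernel (Suc 0) ladder_potential t"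
proof -
  have "ladder_potential t = (\<Sum>n. ladder_kernel (Suc n) ladder_excess t) + ladder_kernel 0 ladder_excess t"
    unfolding ladder_potential_def by (subst suminf_offset[of _ 1]) simp_all
  also have "(\<Sum>n. ladder_kernel (Suc n) ladder_excess t)
      = (\<Sum>n. ladder_kernel (Suc 0) (ladder_kernel n ladder_excess) t)"
    by (intro suminf_cong ladder_kernel_Suc' measurable_ladder_excess)
  also have "\<dots> = ladder_kernel (Suc 0) ladder_potential t"
    unfolding ladder_potential_def[abs_def] by (subst ladder_kernel_suminf) auto
  finally show ?thesis
    by (simp add: ladder_kernel_0 add.commute)
qed

text \<open>Iterating the inequality \<open>i\<close> times bounds the \<open>i\<close>-th partial
  sum plus a remainder \<open>K^i f\<close> by \<open>f\<close>; the remainder is nonnegative and is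
  dropped.\<close>

lemma ladder_potential_le_supersolution:
  assumes [measurable]: "f \<in> borel_measurable borel"
    and f: "\<And>t. ladder_excess t + ladder_kernel (Suc 0) f t \<le> f t"
  shows "ladder_potential t \<le> f t"
proof -
  have "(\<Sum>n<i. ladder_kernel n ladder_excess t) + ladder_kernel i f t \<le> f t" for i
  proof (induction i)
    case (Suc i)
    have "ladder_kernel i ladder_excess t + ladder_kernel (Suc i) f t
        = ladder_kernel i (\<lambda>t. ladder_excess t + ladder_kernel (Suc 0) f t) t"
      by (simp add: ladder_kernel_add ladder_kernel_Suc[of f i])
    also have "\<dots> \<le> ladder_kernel i f t"
      by (intro ladder_kernel_le f)
    finally have "(\<Sum>n<i. ladder_kernel n ladder_excess t) +
        (ladder_kernel i ladder_excess t + ladder_kernel (Suc i) f t) \<le> f t"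
      using Suc by (intro order_trans[OF add_left_mono Suc])
    then show ?case
      by (simp add: ac_simps)
  qed (simp add: ladder_kernel_0)
  then have "(\<Sum>n<i. ladder_kernel n ladder_excess t) \<le> f t" for i
    by (meson add_increasing2 dual_order.trans order_refl zero_le)
  then show ?thesis
    unfolding ladder_potential_def by (intro suminf_le_const) auto
qed

text \<open>On a finite epoch the full product is \<open>(1 + x) * (1 + y)\<close>, so its excess
  \<open>x + y + x * y\<close> dominates \<open>x + y\<close>. On an infinite epoch the ladder
  product is the full product.\<close>

lemma full_product_recursion:
  "(ladder_product t w - 1) + (case ladder_epoch (pos w) (Suc 0) of
      enat m \<Rightarrow> 1 * (full_product (t - pos w m) (shift m w) - 1) | \<infinity> \<Rightarrow> 0) \<le> full_product t w - 1"
proof (cases "ladder_epoch (pos w) (Suc 0)")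
  case (enat m)
  define x where "x = partial_product t w m - 1"
  define y where "y = full_product (t - pos w m) (shift m w) - 1"
  have x: "partial_product t w m = 1 + x"
    unfolding x_def using one_le_partial_product by (metis add.commute diff_add_cancel_ennreal)
  have y: "full_product (t - pos w m) (shift m w) = 1 + y"
    unfolding y_def using one_le_full_product by (metis add.commute diff_add_cancel_ennreal)
  have "full_product t w = 1 + (x + y + x * y)"
    unfolding full_product_split[of t w m] x y by (simp add: algebra_simps)
  then have "full_product t w - 1 = x + y + x * y"
    by (simp add: ennreal_add_diff_cancel_left)
  then show ?thesis
    using enat by (simp add: ladder_product_def x_def[symmetric] y_def[symmetric])
qed (simp add: ladder_product_def)

lemma ladder_potential_le_total_excess: "ladder_potential t \<le> total_excess t"
proof (rule ladder_potential_le_supersolution)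
  fix t
  \<comment> \<open>Strong Markov with \<open>A = 1\<close> replaces the excess of the shifted
    sequence by its mean, turning the pathwise recursion into the supersolution inequality.\<close>
  have "(\<integral>\<^sup>+w. (case ladder_epoch (pos w) (Suc 0) of
        enat m \<Rightarrow> 1 * (full_product (t - pos w m) (shift m w) - 1) | \<infinity> \<Rightarrow> 0) \<partial>S)
      = (\<integral>\<^sup>+w. (case ladder_epoch (pos w) (Suc 0) of
        enat m \<Rightarrow> 1 * total_excess (t - pos w m) | \<infinity> \<Rightarrow> 0) \<partial>S)"
    unfolding total_excess_def by (intro strong_markov) auto
  then have "ladder_kernel (Suc 0) total_excess t = (\<integral>\<^sup>+w. (case ladder_epoch (pos w) (Suc 0) of
      enat m \<Rightarrow> 1 * (full_product (t - pos w m) (shift m w) - 1) | \<infinity> \<Rightarrow> 0) \<partial>S)"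
    unfolding ladder_kernel_def at_ladder_def mult_1 by (rule sym)
  then have "ladder_excess t + ladder_kernel (Suc 0) total_excess t =
      (\<integral>\<^sup>+w. (ladder_product t w - 1) + (case ladder_epoch (pos w) (Suc 0) of
        enat m \<Rightarrow> 1 * (full_product (t - pos w m) (shift m w) - 1) | \<infinity> \<Rightarrow> 0) \<partial>S)"
    unfolding ladder_excess_def suminf_enat_eq[symmetric] by (simp add: nn_integral_add)
  also have "\<dots> \<le> total_excess t"
    unfolding total_excess_def by (intro nn_integral_mono full_product_recursion)
  finally show "ladder_excess t + ladder_kernel (Suc 0) total_excess t \<le> total_excess t" .
qed simp

lemma full_expectation: "(\<integral>\<^sup>+w. full_product t w \<partial>S) = 1 + total_excess t"
proof -
  have "(\<integral>\<^sup>+w. full_product t w \<partial>S) = (\<integral>\<^sup>+w. 1 + (full_product t w - 1) \<partial>S)"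
    using one_le_full_product by (intro nn_integral_cong) (metis add.commute diff_add_cancel_ennreal)
  also have "\<dots> = 1 + total_excess t"
    unfolding total_excess_def by (subst nn_integral_add) (auto simp: emeasure_space_1)
  finally show ?thesis .
qed

lemma ladder_expectation: "(\<integral>\<^sup>+w. ladder_product t w \<partial>S) = 1 + ladder_excess t"
proof -
  have "(\<integral>\<^sup>+w. ladder_product t w \<partial>S) = (\<integral>\<^sup>+w. 1 + (ladder_product t w - 1) \<partial>S)"
    using one_le_ladder_product by (intro nn_integral_cong) (metis add.commute diff_add_cancel_ennreal)
  also have "\<dots> = 1 + ladder_excess t"
    unfolding ladder_excess_def by (subst nn_integral_add) (auto simp: emeasure_space_1)
  finally show ?thesis .
qed

lemma AE_ladder_epoch_finite: "AE w in S. \<exists>m. ladder_epoch (pos w) (Suc 0) = enat m"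
  using ladder_finite
proof eventually_elim
  case (elim w)
  then obtain n where "0 < n" "0 < pos w n"
    by (auto simp: pos_def)
  then show ?case
    by (auto elim: ladder_epoch_Suc_0_le[of n "pos w"])
qed

section \<open>Upper bound through partial products\<close>

text \<open>These are the \<open>\<psi>\<close> functions of the overview; \<open>n\<close> counts
  steps of the walk, not ladder epochs.\<close>

definition partial_expectation :: "nat \<Rightarrow> real \<Rightarrow> ennreal" where
  "partial_expectation n t = (\<integral>\<^sup>+w. partial_product t w n \<partial>S)"

lemma measurable_partial_expectation [measurable]: "partial_expectation n \<in> borel_measurable borel"
  unfolding partial_expectation_def by measurable

lemma partial_expectation_mono: "s \<le> t \<Longrightarrow> partial_expectation n s \<le> partial_expectation n t"
  unfolding partial_expectation_def by (intro nn_integral_mono partial_product_mono)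

lemma partial_product_comb_seq: "partial_product t (comb_seq m w w') m = partial_product t w m"
  unfolding partial_product_def factor_def pos_def
  by (intro prod.cong refl) (auto simp: comb_seq_def)

text \<open>Extend the product to \<open>n\<close> further steps after the first ladder epoch and
  apply strong Markov there. The product and the ladder height are dependent; they are decoupled by
  monotonicity in time.\<close>

lemma partial_expectation_Suc_le:
  "partial_expectation (Suc n) t \<le>
    ladder_excess t * partial_expectation n t + ladder_kernel (Suc 0) (partial_expectation n) t"
proof -
  have "partial_expectation (Suc n) t \<le> (\<integral>\<^sup>+w. (case ladder_epoch (pos w) (Suc 0) of
      enat m \<Rightarrow> partial_product t w m * partial_product (t - pos w m) (shift m w) n | \<infinity> \<Rightarrow> 0) \<partial>S)"
    unfolding partial_expectation_def
  proof (rule nn_integral_mono_AE, use AE_ladder_epoch_finite in eventually_elim)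
    case (elim w)
    then obtain m where m: "ladder_epoch (pos w) (Suc 0) = enat m"
      by auto
    then have "0 < m"
      unfolding ladder_epoch_Suc_0_eq_enat_iff by simp
    \<comment> \<open>The epoch is at least 1, so \<open>Suc n\<close> steps are covered by
      \<open>m + n\<close>.\<close>
    then have "partial_product t w (Suc n) \<le> partial_product t w (m + n)"
      by (intro partial_product_le) simp
    then show ?case
      by (simp add: m partial_product_add)
  qed
  also have "\<dots> = (\<integral>\<^sup>+w. (case ladder_epoch (pos w) (Suc 0) of
      enat m \<Rightarrow> partial_product t w m * partial_expectation n (t - pos w m) | \<infinity> \<Rightarrow> 0) \<partial>S)"
    unfolding partial_expectation_def by (intro strong_markov) (auto simp: partial_product_comb_seq)
  also have "\<dots> \<le> (\<integral>\<^sup>+w. (ladder_product t w - 1) * partial_expectation n t +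
      at_ladder (Suc 0) (\<lambda>u. partial_expectation n (t - u)) w \<partial>S)"
  proof (rule nn_integral_mono)
    fix w
    show "(case ladder_epoch (pos w) (Suc 0) of
        enat m \<Rightarrow> partial_product t w m * partial_expectation n (t - pos w m) | \<infinity> \<Rightarrow> 0)
      \<le> (ladder_product t w - 1) * partial_expectation n t +
        at_ladder (Suc 0) (\<lambda>u. partial_expectation n (t - u)) w"
    proof (cases "ladder_epoch (pos w) (Suc 0)")
      case (enat m)
      then have "0 < pos w m"
        unfolding ladder_epoch_Suc_0_eq_enat_iff by simp
      \<comment> \<open>Write the product as excess plus 1. The positive height is discarded in the
        excess part only; the remaining part keeps its shift and becomes the kernel term.\<close>
      then have "partial_product t w m * partial_expectation n (t - pos w m)
          \<le> (partial_product t w m - 1) * partial_expectation n t + partial_expectation n (t - pos w m)"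
        by (subst ennreal_mult_diff_1[OF one_le_partial_product])
           (intro add_mono mult_left_mono partial_expectation_mono, auto)
      then show ?thesis
        by (simp add: enat at_ladder_def ladder_product_def)
    qed simp
  qed
  also have "\<dots> = ladder_excess t * partial_expectation n t + ladder_kernel (Suc 0) (partial_expectation n) t"
    unfolding ladder_excess_def ladder_kernel_def by (simp add: nn_integral_add nn_integral_multc)
  finally show ?thesis .
qed

lemma ladder_kernel_one_le: "ladder_kernel (Suc 0) (\<lambda>t. 1) t \<le> 1"
proof -
  have "ladder_kernel (Suc 0) (\<lambda>t. 1) t \<le> (\<integral>\<^sup>+w. 1 \<partial>S)"
    unfolding ladder_kernel_def at_ladder_def by (intro nn_integral_mono) (auto split: enat.split)
  then show ?thesis
    by (simp add: emeasure_space_1)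
qed

lemma ladder_kernel_cmult:
  assumes [measurable]: "f \<in> borel_measurable borel"
  shows "ladder_kernel n (\<lambda>t. c * f t) t = c * ladder_kernel n f t"
proof -
  have *: "at_ladder n (\<lambda>u. c * f (t - u)) = (\<lambda>w. c * at_ladder n (\<lambda>u. f (t - u)) w)"
    unfolding at_ladder_def by (auto split: enat.split)
  show ?thesis
    unfolding ladder_kernel_def * by (simp add: nn_integral_cmult)
qed

text \<open>The hypothesis on \<open>c\<close> makes the induction close: the bound implies that the
  expectation is at most \<open>c\<close>, so the next one is at most
  \<open>c h + K (1 + c r)\<close>, which is at most
  \<open>1 + c (h + K r) = 1 + c r\<close>.\<close>

lemma partial_expectation_bound:
  assumes c: "1 + c * ladder_potential t0 \<le> c" and t: "t \<le> t0"
  shows "partial_expectation n t \<le> 1 + c * ladder_potential t"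
  using t
proof (induction n arbitrary: t)
  case 0
  then show ?case
    by (simp add: partial_expectation_def partial_product_def emeasure_space_1)
next
  case (Suc n)
  have "partial_expectation n t \<le> 1 + c * ladder_potential t"
    by (intro Suc.IH Suc.prems)
  also have "\<dots> \<le> 1 + c * ladder_potential t0"
    using Suc.prems by (intro add_left_mono mult_left_mono ladder_potential_mono) auto
  finally have le_c: "partial_expectation n t \<le> c"
    using c by (rule order_trans)
  have "ladder_kernel (Suc 0) (partial_expectation n) t
      \<le> ladder_kernel (Suc 0) (\<lambda>s. 1 + c * ladder_potential s) t"
    unfolding ladder_kernel_def
  proof (rule nn_integral_mono)
    fix w
    have "0 < pos w m" if "ladder_epoch (pos w) (Suc 0) = enat m" for m
      using that unfolding ladder_epoch_Suc_0_eq_enat_iff by simp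
    \<comment> \<open>Ladder heights are positive, so the induction hypothesis for all times up to
      \<open>t0\<close> applies.\<close>
    then have "t - pos w m \<le> t0" if "ladder_epoch (pos w) (Suc 0) = enat m" for m
      using that Suc.prems by (meson diff_le_eq less_imp_le add_increasing2 order_trans)
    then show "at_ladder (Suc 0) (\<lambda>u. partial_expectation n (t - u)) w
        \<le> at_ladder (Suc 0) (\<lambda>u. 1 + c * ladder_potential (t - u)) w"
      unfolding at_ladder_def by (cases "ladder_epoch (pos w) (Suc 0)") (simp_all add: Suc.IH)
  qed
  also have "\<dots> = ladder_kernel (Suc 0) (\<lambda>s. 1) t + c * ladder_kernel (Suc 0) ladder_potential t"
    by (simp add: ladder_kernel_add ladder_kernel_cmult)
  also have "\<dots> \<le> 1 + c * ladder_kernel (Suc 0) ladder_potential t"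
    by (intro add_right_mono ladder_kernel_one_le)
  finally have "partial_expectation (Suc n) t
      \<le> ladder_excess t * c + (1 + c * ladder_kernel (Suc 0) ladder_potential t)"
    using le_c by (intro order_trans[OF partial_expectation_Suc_le] add_mono mult_left_mono) auto
  also have "\<dots> = 1 + c * ladder_potential t"
    unfolding ladder_potential_eq[of t] by (simp add: algebra_simps)
  finally show ?case .
qed

lemma total_excess_finite_if_ladder_potential_less_1:
  assumes "ladder_potential t < 1"
  shows "total_excess t < \<infinity>"
proof -
  obtain x where x: "ladder_potential t = ennreal x" "0 \<le> x" "x < 1"
    using assms by (cases "ladder_potential t") (auto simp: ennreal_less_one_iff)
  \<comment> \<open>The solution of \<open>1 + c x = c\<close>. The bound is uniform in
    \<open>n\<close>, so monotone convergence carries it to the full product.\<close>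
  define c where "c = ennreal (1 / (1 - x))"
  have "1 + c * ladder_potential t = ennreal (1 + 1 / (1 - x) * x)"
    using x by (simp add: c_def ennreal_mult'[symmetric] ennreal_plus)
  also have "1 + 1 / (1 - x) * x = 1 / (1 - x)"
    using x by (simp add: field_simps)
  finally have c: "1 + c * ladder_potential t = c"
    by (simp add: c_def)
  have "(\<integral>\<^sup>+w. full_product t w \<partial>S) = (SUP n. partial_expectation n t)"
    unfolding full_product_def partial_expectation_def
    by (rule nn_integral_monotone_convergence_SUP)
       (auto intro!: incseq_SucI le_funI partial_product_le)
  also have "\<dots> \<le> c"
    using partial_expectation_bound[of c t t] c by (intro SUP_least) auto
  also have "c < \<infinity>"
    by (simp add: c_def)
  finally show ?thesis
    unfolding full_expectation by simp
qed

section \<open>Behaviour far to the left\<close>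

text \<open>Up to an almost surely finite epoch there are finitely many factors, each tending to 1.
  The full product would not allow this argument, so smallness is proved for the potential.\<close>

lemma tendsto_ladder_product:
  "AE w in S. (\<lambda>k. ladder_product (t - real k) w) \<longlonglongrightarrow> 1"
proof -
  have "AE w in S. \<forall>n. (\<lambda>k. g (- real k) (w n)) \<longlonglongrightarrow> 1"
  proof (subst AE_all_countable, rule allI)
    have "AE e in N. (\<lambda>k. g (- real k) e) \<longlonglongrightarrow> 1"
      using g_lim
    proof eventually_elim
      case (elim e)
      have "decseq (\<lambda>k. g (- real k) e)"
        by (intro decseq_SucI g_mono) simp
      then show ?case
        using LIMSEQ_INF elim by fastforce
    qed
    then show "AE w in S. (\<lambda>k. g (- real k) (w n)) \<longlonglongrightarrow> 1" for n
      by (intro AE_PiM_component) (auto intro: prob_space)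
  qed
  with AE_ladder_epoch_finite show ?thesis
  proof eventually_elim
    case (elim w)
    then obtain m where m: "ladder_epoch (pos w) (Suc 0) = enat m"
      by auto
    have "(\<lambda>k. factor (t - real k) w n) \<longlonglongrightarrow> 1" for n
    proof -
      \<comment> \<open>Delaying by \<open>j\<close> absorbs the fixed offset
        \<open>t - S_n\<close>, so that \<open>g (- real k)\<close> dominates the factor.\<close>
      obtain j :: nat where j: "t - pos w n \<le> real j"
        using real_arch_simple by auto
      have "(\<lambda>k. factor (t - real (k + j)) w n) \<longlonglongrightarrow> 1"
      proof (rule tendsto_sandwich[OF _ _ tendsto_const])
        show "\<forall>\<^sub>F k in sequentially. factor (t - real (k + j)) w n \<le> g (- real k) (w n)"
          unfolding factor_def using j by (intro always_eventually allI g_mono) simp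
        show "(\<lambda>k. g (- real k) (w n)) \<longlonglongrightarrow> 1"
          using elim by simp
      qed (simp_all add: elim one_le_factor)
      then show ?thesis
        by (rule LIMSEQ_offset)
    qed
    then have "(\<lambda>k. partial_product (t - real k) w n) \<longlonglongrightarrow> 1" for n
    proof (induction n)
      case (Suc n)
      then have "(\<lambda>k. partial_product (t - real k) w n * factor (t - real k) w n) \<longlonglongrightarrow> 1 * 1"
        by (intro tendsto_mult_ennreal) auto
      then show ?case
        by (simp add: partial_product_def)
    qed (simp add: partial_product_def)
    then show ?case
      by (simp add: ladder_product_def m)
  qed
qed

lemma tendsto_ladder_excess:
  assumes "ladder_excess t < \<infinity>"
  shows "(\<lambda>k. ladder_excess (t - real k)) \<longlonglongrightarrow> 0"
proof -
  have "(\<lambda>k. \<integral>\<^sup>+w. (ladder_product (t - real k) w - 1) \<partial>S) \<longlonglongrightarrow> (\<integral>\<^sup>+w. 0 \<partial>S)"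
  proof (rule nn_integral_dominated_convergence[where w = "\<lambda>w. ladder_product t w - 1"])
    show "AE w in S. ladder_product (t - real k) w - 1 \<le> ladder_product t w - 1" for k
      by (intro always_eventually allI ennreal_minus_mono ladder_product_mono) auto
    show "AE w in S. (\<lambda>k. ladder_product (t - real k) w - 1) \<longlonglongrightarrow> 0"
      using tendsto_ladder_product[of t]
    proof eventually_elim
      case (elim w)
      then have "(\<lambda>k. ladder_product (t - real k) w - 1) \<longlonglongrightarrow> 1 - 1"
        by (intro tendsto_diff_ennreal_general) auto
      then show ?case
        by simp
    qed
  qed (use assms in \<open>auto simp: ladder_excess_def\<close>)
  then show ?thesis
    by (simp add: ladder_excess_def)
qed

text \<open>Dominated convergence is used twice: over paths for each fixed \<open>n\<close>, then
  over \<open>n\<close> under counting measure. The finite potential at \<open>t\<close> provides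
  both majorants.\<close>

lemma tendsto_ladder_potential:
  assumes "ladder_potential t < \<infinity>" and finite: "\<And>s. ladder_excess s < \<infinity>"
  shows "(\<lambda>k. ladder_potential (t - real k)) \<longlonglongrightarrow> 0"
proof -
  have "(\<lambda>k. ladder_kernel n ladder_excess (t - real k)) \<longlonglongrightarrow> 0" for n
  proof -
    have "ladder_kernel n ladder_excess t \<le> ladder_potential t"
      unfolding ladder_potential_def
      using sum_le_suminf[of "\<lambda>n. ladder_kernel n ladder_excess t" "{n}"] by simp
    with assms(1) have *: "ladder_kernel n ladder_excess t < \<infinity>"
      by (rule le_less_trans[rotated])
    have "(\<lambda>k. \<integral>\<^sup>+w. at_ladder n (\<lambda>u. ladder_excess (t - real k - u)) w \<partial>S) \<longlonglongrightarrow> (\<integral>\<^sup>+w. 0 \<partial>S)"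
    proof (rule nn_integral_dominated_convergence[where w = "at_ladder n (\<lambda>u. ladder_excess (t - u))"])
      show "AE w in S. at_ladder n (\<lambda>u. ladder_excess (t - real k - u)) w
          \<le> at_ladder n (\<lambda>u. ladder_excess (t - u)) w" for k
        unfolding at_ladder_def by (auto split: enat.split intro!: always_eventually ladder_excess_mono)
      have "(\<lambda>k. ladder_excess (t - real k - u)) \<longlonglongrightarrow> 0" for u
        using tendsto_ladder_excess[OF finite[of "t - u"]] by (simp add: algebra_simps)
      then have "(\<lambda>k. at_ladder n (\<lambda>u. ladder_excess (t - real k - u)) w) \<longlonglongrightarrow> 0" for w
        unfolding at_ladder_def by (cases "ladder_epoch (pos w) n") auto
      then show "AE w in S. (\<lambda>k. at_ladder n (\<lambda>u. ladder_excess (t - real k - u)) w) \<longlonglongrightarrow> 0"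
        by simp
    qed (use * in \<open>auto simp: ladder_kernel_def\<close>)
    then show ?thesis
      by (simp add: ladder_kernel_def)
  qed
  then have "(\<lambda>k. \<integral>\<^sup>+n. ladder_kernel n ladder_excess (t - real k) \<partial>count_space UNIV) \<longlonglongrightarrow>
      (\<integral>\<^sup>+(n::nat). 0 \<partial>count_space UNIV)"
    using assms(1)
    by (intro nn_integral_dominated_convergence[where w = "\<lambda>n. ladder_kernel n ladder_excess t"])
       (auto intro!: ladder_kernel_mono ladder_excess_mono
         simp: ladder_potential_def nn_integral_count_space_nat AE_count_space)
  then show ?thesis
    by (simp add: nn_integral_count_space_nat ladder_potential_def)
qed

lemma ladder_excess_le_potential: "ladder_excess t \<le> ladder_potential t"
  by (subst ladder_potential_eq) simp

lemma total_excess_finite_somewhere: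
  assumes "\<And>t. ladder_potential t < \<infinity>"
  obtains t where "total_excess t < \<infinity>"
proof -
  have "(\<lambda>k. ladder_potential (0 - real k)) \<longlonglongrightarrow> 0"
    using assms by (intro tendsto_ladder_potential le_less_trans[OF ladder_excess_le_potential]) auto
  then have "\<forall>\<^sub>F k in sequentially. ladder_potential (0 - real k) < 1"
    by (rule order_tendstoD) simp
  then obtain k :: nat where "ladder_potential (0 - real k) < 1"
    unfolding eventually_sequentially by blast
  then show thesis
    by (intro that total_excess_finite_if_ladder_potential_less_1)
qed

section \<open>Propagation of finiteness to all times\<close>

text \<open>The event of a negative step is the countable union of the events of a step below
  \<open>- 1 / (n + 1)\<close>, so one of these has positive probability.\<close>

lemma negative_step:
  obtains \<delta> where "0 < \<delta>" "emeasure N {e \<in> space N. \<xi> e < - \<delta>} > 0"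
proof -
  have "{e \<in> space N. \<xi> e < 0} = (\<Union>n. {e \<in> space N. \<xi> e < - inverse (real (Suc n))})"
  proof (intro set_eqI iffI)
    fix e assume "e \<in> {e \<in> space N. \<xi> e < 0}"
    then have "e \<in> space N" "0 < - \<xi> e"
      by auto
    moreover from reals_Archimedean[OF this(2)] obtain n where "inverse (real (Suc n)) < - \<xi> e"
      by auto
    ultimately show "e \<in> (\<Union>n. {e \<in> space N. \<xi> e < - inverse (real (Suc n))})"
      by (intro UN_I[of n]) auto
  next
    fix e assume "e \<in> (\<Union>n. {e \<in> space N. \<xi> e < - inverse (real (Suc n))})"
    then obtain n where "e \<in> space N" "\<xi> e < - inverse (real (Suc n))"
      by auto
    moreover have "0 < inverse (real (Suc n))"
      by simp
    ultimately show "e \<in> {e \<in> space N. \<xi> e < 0}"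
      by (auto simp del: inverse_positive_iff_positive)
  qed
  moreover have "emeasure N {e \<in> space N. \<xi> e < 0} \<noteq> 0"
    using xi_neg by simp
  ultimately have "\<not> (\<forall>n. emeasure N {e \<in> space N. \<xi> e < - inverse (real (Suc n))} = 0)"
    by (auto intro!: emeasure_UN_eq_0)
  then obtain n where "emeasure N {e \<in> space N. \<xi> e < - inverse (real (Suc n))} \<noteq> 0"
    by auto
  then show thesis
    by (intro that[of "inverse (real (Suc n))"]) (auto simp: zero_less_iff_neq_zero)
qed

text \<open>Restrict to a first step below \<open>- \<delta>\<close>; by the Markov property the
  shifted sequence is independent of it.\<close>

lemma negative_step_bound:
  assumes [measurable]: "J \<in> borel_measurable S"
    and J: "\<And>w. \<xi> (w 0) < - \<delta> \<Longrightarrow> J (shift (Suc 0) w) \<le> J' w"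
  shows "emeasure N {e \<in> space N. \<xi> e < - \<delta>} * (\<integral>\<^sup>+w. J w \<partial>S) \<le> (\<integral>\<^sup>+w. J' w \<partial>S)"
proof -
  define E where "E = {e \<in> space N. \<xi> e < - \<delta>}"
  have [measurable]: "E \<in> sets N"
    unfolding E_def by measurable
  have "emeasure N E = (\<integral>\<^sup>+e. indicator E e \<partial>distr S N (\<lambda>w. w 0))"
    unfolding PiM_component[OF UNIV_I] by simp
  also have "\<dots> = (\<integral>\<^sup>+w. indicator E (w 0) \<partial>S)"
    by (rule nn_integral_distr) measurable
  finally have "emeasure N E * (\<integral>\<^sup>+w. J w \<partial>S) = (\<integral>\<^sup>+w. indicator E (w 0) * (\<integral>\<^sup>+w'. J w' \<partial>S) \<partial>S)"
    by (simp add: nn_integral_multc)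
  also have "\<dots> = (\<integral>\<^sup>+w. indicator E (w 0) * J (shift (Suc 0) w) \<partial>S)"
    by (intro markov[symmetric, of _ "\<lambda>_. J"]) (auto simp: comb_seq_def)
  also have "\<dots> \<le> (\<integral>\<^sup>+w. J' w \<partial>S)"
    using J by (intro nn_integral_mono) (auto simp: E_def indicator_def)
  finally show ?thesis
    unfolding E_def .
qed

lemma pos_Suc_0: "pos w (Suc 0) = \<xi> (w 0)"
  by (simp add: pos_def)

text \<open>Drop the first factor, which is at least 1; the rest starts at
  \<open>t - \<xi> (w 0)\<close>, no earlier than \<open>t + \<delta>\<close>.\<close>

lemma full_product_shift_le:
  assumes "\<xi> (w 0) \<le> - \<delta>"
  shows "full_product (t + \<delta>) (shift (Suc 0) w) \<le> full_product t w"
proof -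
  have "full_product (t + \<delta>) (shift (Suc 0) w) \<le> 1 * full_product (t - pos w (Suc 0)) (shift (Suc 0) w)"
    using assms by (auto simp: pos_Suc_0 intro: full_product_mono)
  also have "\<dots> \<le> full_product t w"
    by (subst full_product_split[of t w "Suc 0"]) (intro mult_right_mono one_le_partial_product zero_le)
  finally show ?thesis .
qed

text \<open>After a nonpositive first step, a walk that has climbed above 0 has also climbed above
  its position after that step. Hence the shifted walk reaches its first ladder epoch at most
  \<open>m - 1\<close> steps in.\<close>

lemma ladder_product_shift_le:
  assumes "\<xi> (w 0) \<le> - \<delta>" "0 \<le> \<delta>"
  shows "ladder_product (t + \<delta>) (shift (Suc 0) w) \<le> ladder_product t w"
proof (cases "ladder_epoch (pos w) (Suc 0)")
  case (enat m)
  then have m: "0 < m" "0 < pos w m"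
    unfolding ladder_epoch_Suc_0_eq_enat_iff by auto
  then obtain k where k: "m = Suc 0 + k"
    by (metis add.left_neutral add_Suc not0_implies_Suc less_irrefl)
  have "0 < pos (shift (Suc 0) w) k"
    using m(2) assms unfolding k pos_add pos_Suc_0 by simp
  moreover from this have "0 < k"
    by (cases k) auto
  ultimately obtain j where j: "ladder_epoch (pos (shift (Suc 0) w)) (Suc 0) = enat j" "j \<le> k"
    using ladder_epoch_Suc_0_le[of k "pos (shift (Suc 0) w)"] by auto
  have "partial_product (t + \<delta>) (shift (Suc 0) w) j \<le> partial_product (t - pos w (Suc 0)) (shift (Suc 0) w) j"
    using assms by (intro partial_product_mono) (simp add: pos_Suc_0)
  also have "\<dots> \<le> 1 * partial_product (t - pos w (Suc 0)) (shift (Suc 0) w) k"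
    using partial_product_le[OF j(2)] by simp
  also have "\<dots> \<le> partial_product t w m"
    unfolding k partial_product_add by (intro mult_right_mono one_le_partial_product zero_le)
  finally show ?thesis
    by (simp add: ladder_product_def enat j)
next
  case infinity
  then show ?thesis
    using order_trans[OF ladder_product_le_full full_product_shift_le[of w \<delta> t, OF assms(1)]]
    by (simp add: ladder_product_def[of t w])
qed

text \<open>As \<open>p\<close> is positive, finiteness moves from a time to that time plus
  \<open>\<delta>\<close>; monotonicity covers all times in between and to the left.\<close>

lemma finite_everywhere:
  fixes f :: "real \<Rightarrow> ennreal"
  assumes mono: "\<And>s t. s \<le> t \<Longrightarrow> f s \<le> f t"
    and "0 < \<delta>" "0 < p" and step: "\<And>t. p * f (t + \<delta>) \<le> f t"
    and fin: "f t0 < \<infinity>"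
  shows "f t < \<infinity>"
proof -
  have *: "f (t0 + real n * \<delta>) < \<infinity>" for n
  proof (induction n)
    case (Suc n)
    have "p * f (t0 + real n * \<delta> + \<delta>) < \<infinity>"
      using step Suc by (rule le_less_trans)
    then have "f (t0 + real n * \<delta> + \<delta>) < \<infinity>"
      using \<open>0 < p\<close> by (auto simp: ennreal_mult_eq_top_iff less_top[symmetric])
    then show ?case
      by (simp add: algebra_simps)
  qed (use fin in simp)
  obtain n :: nat where "t - t0 \<le> real n * \<delta>"
    using \<open>0 < \<delta>\<close> reals_Archimedean3[of \<delta>] by (meson less_imp_le)
  then have "f t \<le> f (t0 + real n * \<delta>)"
    by (intro mono) simp
  then show ?thesis
    using * by (rule le_less_trans)
qed

lemma total_excess_finite_everywhere:
  assumes "total_excess s < \<infinity>"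
  shows "total_excess t < \<infinity>"
proof -
  obtain \<delta> where \<delta>: "0 < \<delta>" "emeasure N {e \<in> space N. \<xi> e < - \<delta>} > 0"
    by (rule negative_step)
  show ?thesis
  proof (rule finite_everywhere[of total_excess, OF total_excess_mono \<delta> _ assms])
    show "emeasure N {e \<in> space N. \<xi> e < - \<delta>} * total_excess (t + \<delta>) \<le> total_excess t" for t
      unfolding total_excess_def
      by (intro negative_step_bound ennreal_minus_mono full_product_shift_le) auto
  qed
qed

text \<open>The step inequality is proved for the ladder excess, then integrated over each ladder
  height and summed.\<close>

lemma ladder_potential_finite_everywhere:
  assumes "ladder_potential s < \<infinity>"
  shows "ladder_potential t < \<infinity>"
proof -
  obtain \<delta> where \<delta>: "0 < \<delta>" "emeasure N {e \<in> space N. \<xi> e < - \<delta>} > 0" (is "0 < ?p")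
    by (rule negative_step)
  have step: "?p * ladder_excess (t + \<delta>) \<le> ladder_excess t" for t
    unfolding ladder_excess_def using \<delta>
    by (intro negative_step_bound ennreal_minus_mono ladder_product_shift_le) auto
  have "?p * ladder_potential (t + \<delta>) \<le> ladder_potential t" for t
  proof -
    have "?p * ladder_kernel n ladder_excess (t + \<delta>) \<le> ladder_kernel n ladder_excess t" for n
    proof -
      have "?p * ladder_kernel n ladder_excess (t + \<delta>)
          = (\<integral>\<^sup>+w. ?p * at_ladder n (\<lambda>u. ladder_excess (t + \<delta> - u)) w \<partial>S)"
        unfolding ladder_kernel_def by (simp add: nn_integral_cmult)
      also have "\<dots> \<le> (\<integral>\<^sup>+w. at_ladder n (\<lambda>u. ladder_excess (t - u)) w \<partial>S)"
      proof (rule nn_integral_mono)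
        fix w
        show "?p * at_ladder n (\<lambda>u. ladder_excess (t + \<delta> - u)) w \<le> at_ladder n (\<lambda>u. ladder_excess (t - u)) w"
          unfolding at_ladder_def using step[of "t - pos w m" for m]
          by (cases "ladder_epoch (pos w) n") (auto simp: algebra_simps)
      qed
      finally show ?thesis
        unfolding ladder_kernel_def .
    qed
    then show ?thesis
      unfolding ladder_potential_def by (subst ennreal_suminf_cmult[symmetric]) (intro suminf_le, auto)
  qed
  from finite_everywhere[of ladder_potential, OF ladder_potential_mono \<delta> this assms] show ?thesis .
qed

text \<open>Pathwise, the sum of the excesses of the factors is at most the excess of their product.
  The Markov property at step \<open>n\<close> replaces the \<open>n\<close>-th factor by its mean
  given the position.\<close>

lemma mean_excess_sum_le_total_excess:
  "(\<Sum>n. \<integral>\<^sup>+w. (\<integral>\<^sup>+e. g (t - pos w n) e \<partial>N) - 1 \<partial>S) \<le> total_excess t"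
proof -
  have "(\<integral>\<^sup>+w. (\<integral>\<^sup>+e. g (t - pos w n) e \<partial>N) - 1 \<partial>S) = (\<integral>\<^sup>+w. factor t w n - 1 \<partial>S)" for n
  proof -
    have inner: "(\<integral>\<^sup>+e. g s e \<partial>N) - 1 = (\<integral>\<^sup>+w. g s (w 0) - 1 \<partial>S)" for s
    proof -
      have "(\<integral>\<^sup>+e. g s e \<partial>N) - 1 = (\<integral>\<^sup>+e. g s e - 1 \<partial>N)"
        by (subst nn_integral_diff) (auto simp: M.emeasure_space_1 one_le_g)
      also have "\<dots> = (\<integral>\<^sup>+e. g s e - 1 \<partial>distr S N (\<lambda>w. w 0))"
        unfolding PiM_component[OF UNIV_I] ..
      also have "\<dots> = (\<integral>\<^sup>+w. g s (w 0) - 1 \<partial>S)"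
        by (rule nn_integral_distr) measurable
      finally show ?thesis .
    qed
    have "(\<integral>\<^sup>+w. 1 * (g (t - pos w n) (shift n w 0) - 1) \<partial>S)
        = (\<integral>\<^sup>+w. 1 * (\<integral>\<^sup>+w'. g (t - pos w n) (w' 0) - 1 \<partial>S) \<partial>S)"
      by (rule markov[of "\<lambda>_. 1" "\<lambda>x w. g (t - x) (w 0) - 1"]) auto
    then show ?thesis
      by (simp add: inner factor_def shift_def)
  qed
  then have "(\<Sum>n. \<integral>\<^sup>+w. (\<integral>\<^sup>+e. g (t - pos w n) e \<partial>N) - 1 \<partial>S) = (\<integral>\<^sup>+w. (\<Sum>n. factor t w n - 1) \<partial>S)"
    by (simp add: nn_integral_suminf factor_def)
  also have "\<dots> \<le> total_excess t"
    unfolding total_excess_def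
  proof (intro nn_integral_mono)
    fix w
    have "(\<Sum>n<N. factor t w n - 1) \<le> full_product t w - 1" for N
    proof -
      have "1 + (\<Sum>n<N. factor t w n - 1) \<le> full_product t w"
        using one_add_sum_le_prod_ennreal[of "factor t w" N] one_le_factor partial_product_le_full[of t w N]
        unfolding partial_product_def by (auto intro: order_trans)
      then have "1 + (\<Sum>n<N. factor t w n - 1) - 1 \<le> full_product t w - 1"
        by (intro ennreal_minus_mono) auto
      then show ?thesis
        by (simp add: ennreal_add_diff_cancel_left)
    qed
    then show "(\<Sum>n. factor t w n - 1) \<le> full_product t w - 1"
      by (intro suminf_le_const) auto
  qed
  finally show ?thesis .
qed

end

section \<open>Renewal shot noise\<close>

locale renewal_shot_noise = prob_space M for M :: "'w measure" +
  fixes X :: "real \<Rightarrow> 'w \<Rightarrow> real" and \<xi> :: "'w \<Rightarrow> real"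
    and Xs :: "nat \<Rightarrow> real \<Rightarrow> 'w \<Rightarrow> real" and \<xi>s :: "nat \<Rightarrow> 'w \<Rightarrow> real"
    and a :: real
  assumes step_measurable [measurable]: "\<xi> \<in> borel_measurable M"
    and process: "nonneg_nondecreasing_process M X"
    and process_lim: "AE \<omega> in M. ((\<lambda>t. X t \<omega>) \<longlongrightarrow> 0) at_bot"
    and copies: "independent_copies M X \<xi> Xs \<xi>s"
    and divergent: "positively_divergent M (walk \<xi>s)"
    and step_neg: "measure M {\<omega>\<in>space M. \<xi> \<omega> < 0} > 0"
    and a_pos: "a > 0"
begin

section \<open>Transfer to the canonical sequence space\<close>

definition law :: "((real \<Rightarrow> real) \<times> real) measure" where
  "law = distr M pair_space (\<lambda>\<omega>. (\<lambda>t. X t \<omega>, \<xi> \<omega>))"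

definition path :: "'w \<Rightarrow> nat \<Rightarrow> (real \<Rightarrow> real) \<times> real" where
  "path \<omega> n = (\<lambda>t. Xs (Suc n) t \<omega>, \<xi>s (Suc n) \<omega>)"

abbreviation path_space :: "(nat \<Rightarrow> (real \<Rightarrow> real) \<times> real) measure" where
  "path_space \<equiv> \<Pi>\<^sub>M i\<in>UNIV. law"

lemma sets_law [measurable_cong]: "sets law = sets pair_space"
  by (simp add: law_def)

lemma measurable_pair [measurable]: "(\<lambda>\<omega>. (\<lambda>t. X t \<omega>, \<xi> \<omega>)) \<in> M \<rightarrow>\<^sub>M pair_space"
proof -
  have "(\<lambda>\<omega> t. X t \<omega>) \<in> M \<rightarrow>\<^sub>M (\<Pi>\<^sub>M t\<in>UNIV. borel)"
    using process by (intro measurable_PiM_single') (auto simp: nonneg_nondecreasing_process_def)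
  then show ?thesis
    unfolding pair_space_def by measurable
qed

lemma prob_space_law: "prob_space law"
  unfolding law_def by (rule prob_space_distr) measurable

lemma measurable_copy:
  assumes "1 \<le> n"
  shows "(\<lambda>\<omega>. (\<lambda>t. Xs n t \<omega>, \<xi>s n \<omega>)) \<in> M \<rightarrow>\<^sub>M pair_space"
  using copies assms unfolding independent_copies_def indep_vars_def by auto

lemma measurable_path [measurable]: "path \<in> M \<rightarrow>\<^sub>M path_space"
  unfolding path_def
proof (rule measurable_PiM_single')
  show "(\<lambda>\<omega>. (\<lambda>t. Xs (Suc n) t \<omega>, \<xi>s (Suc n) \<omega>)) \<in> M \<rightarrow>\<^sub>M law" for n
    using measurable_copy[of "Suc n"] by (simp add: measurable_cong_sets[OF refl sets_law])
qed (simp add: law_def pair_space_def space_pair_measure space_PiM)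

text \<open>Independence and equal laws give a product measure indexed from 1; the injection
  \<open>Suc\<close> reindexes it from 0.\<close>

lemma distr_path: "distr M path_space path = path_space"
proof -
  let ?Y = "\<lambda>n \<omega>. (\<lambda>t. Xs n t \<omega>, \<xi>s n \<omega>)" and ?I = "{1::nat..}"
  let ?R = "\<lambda>\<omega>. \<lambda>n\<in>?I. ?Y n \<omega>"
  have R: "?R \<in> M \<rightarrow>\<^sub>M (\<Pi>\<^sub>M n\<in>?I. law)"
    using measurable_copy by (intro measurable_restrict) (simp add: measurable_cong_sets[OF refl sets_law])
  have eq: "distr M (\<Pi>\<^sub>M n\<in>?I. law) ?R = (\<Pi>\<^sub>M n\<in>?I. law)"
  proof -
    have "distr M (\<Pi>\<^sub>M n\<in>?I. pair_space) ?R = (\<Pi>\<^sub>M n\<in>?I. distr M pair_space (?Y n))"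
      using copies measurable_copy unfolding independent_copies_def
      by (intro indep_vars_iff_distr_eq_PiM'[THEN iffD1]) simp_all
    also have "\<dots> = (\<Pi>\<^sub>M n\<in>?I. law)"
      using copies unfolding independent_copies_def law_def by (intro PiM_cong) auto
    also have "distr M (\<Pi>\<^sub>M n\<in>?I. pair_space) ?R = distr M (\<Pi>\<^sub>M n\<in>?I. law) ?R"
      by (intro distr_cong refl sets_PiM_cong) (simp add: sets_law)
    finally show ?thesis .
  qed
  have "distr (\<Pi>\<^sub>M n\<in>?I. law) path_space (\<lambda>w. \<lambda>n\<in>UNIV. w (Suc n)) = path_space"
    by (rule distr_PiM_reindex) (auto simp: prob_space_law)
  then have "path_space = distr (distr M (\<Pi>\<^sub>M n\<in>?I. law) ?R) path_space (\<lambda>w. \<lambda>n\<in>UNIV. w (Suc n))"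
    unfolding eq ..
  also have "\<dots> = distr M path_space ((\<lambda>w. \<lambda>n\<in>UNIV. w (Suc n)) \<circ> ?R)"
    by (rule distr_distr[OF _ R]) (intro measurable_restrict measurable_component_singleton, simp)
  also have "(\<lambda>w. \<lambda>n\<in>UNIV. w (Suc n)) \<circ> ?R = path"
    by (intro ext) (simp add: path_def)
  finally show ?thesis by (rule sym)
qed

lemma nn_integral_path:
  "f \<in> borel_measurable path_space \<Longrightarrow> (\<integral>\<^sup>+\<omega>. f (path \<omega>) \<partial>M) = (\<integral>\<^sup>+w. f w \<partial>path_space)"
  using nn_integral_distr[OF measurable_path, of f] by (simp add: distr_path)

lemma walk_eq_sum: "walk \<xi>s n \<omega> = (\<Sum>k<n. snd (path \<omega> k))"
  by (simp add: walk_def path_def sum.atLeast1_atMost_eq)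

lemma shot_noise_walk_law: "shot_noise_walk law snd (upper_factor a)"
proof -
  interpret law: product_prob_space "\<lambda>_. law" "UNIV :: nat set"
    by (intro product_prob_spaceI prob_space_law)
  have [measurable]: "snd \<in> borel_measurable law"
    unfolding measurable_cong_sets[OF sets_law refl] pair_space_def by simp
  have g [measurable]: "(\<lambda>(s, e). upper_factor a s e) \<in> borel_measurable (borel \<Otimes>\<^sub>M law)"
    using measurable_upper_factor
    by (simp add: measurable_cong_sets[OF sets_pair_measure_cong[OF refl sets_law] refl])
  show ?thesis
  proof
    have lim: "AE \<omega> in M. (INF k. upper_factor a (- real k) (\<lambda>t. X t \<omega>, \<xi> \<omega>)) = 1"
      using process_lim AE_space
    proof eventually_elim
      case (elim \<omega>)
      have X: "mono (\<lambda>t. X t \<omega>)" "\<And>t. 0 \<le> X t \<omega>"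
        using process elim(2) by (auto simp: nonneg_nondecreasing_process_def)
      \<comment> \<open>The added 1 is the unit shift paid when bounding the majorant by the
        process.\<close>
      have "filterlim (\<lambda>k. - real k + 1) at_bot sequentially"
        by real_asymp
      with elim(1) have "(\<lambda>k. X (- real k + 1) \<omega>) \<longlonglongrightarrow> 0"
        by (rule filterlim_compose)
      then have "(\<lambda>k. ennreal (exp (a * X (- real k + 1) \<omega>))) \<longlonglongrightarrow> ennreal (exp (a * 0))"
        by (intro tendsto_intros)
      then have exp: "(\<lambda>k. ennreal (exp (a * X (- real k + 1) \<omega>))) \<longlonglongrightarrow> 1"
        by simp
      have le: "upper_factor a (- real k) (\<lambda>t. X t \<omega>, \<xi> \<omega>) \<le> ennreal (exp (a * X (- real k + 1) \<omega>))" for k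
        using X a_pos by (intro upper_factor_le[where x = "\<lambda>t. X t \<omega>"])
      have "(\<lambda>k. upper_factor a (- real k) (\<lambda>t. X t \<omega>, \<xi> \<omega>)) \<longlonglongrightarrow> 1"
        by (rule tendsto_sandwich[OF _ _ tendsto_const exp])
           (intro always_eventually allI one_le_upper_factor a_pos le)+
      then show ?case
        by (rule INF_Lim[rotated]) (rule decseq_SucI, rule upper_factor_mono, simp)
    qed
    show "AE e in law. (INF k. upper_factor a (- real k) e) = 1"
      unfolding law_def using lim by (subst AE_distr_iff) simp_all
    show "0 < emeasure law {e \<in> space law. snd e < 0}"
    proof -
      have "emeasure law {e \<in> space law. snd e < 0} = emeasure M {\<omega> \<in> space M. \<xi> \<omega> < 0}"
      proof -
        have "{e \<in> space law. snd e < 0} \<in> sets pair_space"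
          unfolding sets_law[symmetric] by measurable
        then have "emeasure law {e \<in> space law. snd e < 0}
            = emeasure M ((\<lambda>\<omega>. (\<lambda>t. X t \<omega>, \<xi> \<omega>)) -` {e \<in> space law. snd e < 0} \<inter> space M)"
          unfolding law_def by (rule emeasure_distr[OF measurable_pair])
        also have "(\<lambda>\<omega>. (\<lambda>t. X t \<omega>, \<xi> \<omega>)) -` {e \<in> space law. snd e < 0} \<inter> space M = {\<omega> \<in> space M. \<xi> \<omega> < 0}"
          using measurable_space[OF measurable_pair] by (auto simp: law_def)
        finally show ?thesis .
      qed
      then show ?thesis
        using step_neg by (simp add: emeasure_eq_measure)
    qed
    have "AE \<omega> in M. \<exists>n>0. 0 < (\<Sum>k<n. snd (path \<omega> k))"
      using divergent unfolding positively_divergent_def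
    proof eventually_elim
      case (elim \<omega>)
      then have "\<forall>\<^sub>F n in sequentially. 0 < walk \<xi>s n \<omega>"
        by (simp add: filterlim_at_top_dense)
      then obtain n where "\<And>k. n \<le> k \<Longrightarrow> 0 < walk \<xi>s k \<omega>"
        unfolding eventually_sequentially by auto
      \<comment> \<open>Passing to \<open>Suc n\<close> guarantees a positive index.\<close>
      then have "0 < walk \<xi>s (Suc n) \<omega>"
        by simp
      then show ?case
        unfolding walk_eq_sum by (intro exI[of _ "Suc n"] conjI) simp_all
    qed
    then have "AE w in distr M path_space path. \<exists>n>0. 0 < (\<Sum>k<n. snd (w k))"
      by (subst AE_distr_iff) (simp, measurable)
    then show "AE w in path_space. \<exists>n>0. 0 < (\<Sum>k<n. snd (w k))"
      unfolding distr_path .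
  qed (use g in \<open>auto simp: one_le_upper_factor a_pos upper_factor_mono\<close>)
qed

sublocale L: shot_noise_walk law snd "upper_factor a"
  by (rule shot_noise_walk_law)

lemma pos_path: "L.pos (path \<omega>) n = walk \<xi>s n \<omega>"
  by (simp add: L.pos_def walk_eq_sum)

lemma ladder_epoch_path: "ladder_epoch (\<lambda>k. walk \<xi>s k \<omega>) n = ladder_epoch (L.pos (path \<omega>)) n"
  by (rule arg_cong[where f = "\<lambda>s. ladder_epoch s n"]) (simp add: fun_eq_iff pos_path)

section \<open>Comparison of the noise with its majorant\<close>

definition noise_product :: "real \<Rightarrow> 'w \<Rightarrow> nat \<Rightarrow> ennreal" where
  "noise_product t \<omega> m = (\<Prod>n=1..m. ennreal (exp (a * Xs n (t - walk \<xi>s (n - 1) \<omega>) \<omega>)))"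

lemma noise_product_eq:
  "noise_product t \<omega> m = (\<Prod>n<m. ennreal (exp (a * Xs (Suc n) (t - walk \<xi>s n \<omega>) \<omega>)))"
  unfolding noise_product_def One_nat_def prod.atLeast1_atMost_eq[unfolded One_nat_def] by simp

lemma copy_mono:
  assumes "\<omega> \<in> space M"
  shows "mono (\<lambda>t. Xs (Suc n) t \<omega>)" "0 \<le> Xs (Suc n) t \<omega>"
  using copies assms unfolding independent_copies_def nonneg_nondecreasing_process_def by auto

text \<open>Factorwise comparison, valid on every path. With the next lemma it confines the noise
  products between majorants at \<open>t - 1\<close> and \<open>t\<close>.\<close>

lemma noise_product_le:
  assumes "\<omega> \<in> space M"
  shows "noise_product t \<omega> m \<le> L.partial_product t (path \<omega>) m"
proof -
  have "ennreal (exp (a * Xs (Suc n) (t - walk \<xi>s n \<omega>) \<omega>)) \<le> upper_factor a (t - walk \<xi>s n \<omega>) (path \<omega> n)" for n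
    using le_upper_factor[OF copy_mono[OF assms] a_pos] by (simp add: path_def)
  then show ?thesis
    unfolding noise_product_eq L.partial_product_def L.factor_def pos_path
    by (induction m) (auto intro!: mult_mono)
qed

lemma le_noise_product:
  assumes "\<omega> \<in> space M"
  shows "L.partial_product t (path \<omega>) m \<le> noise_product (t + 1) \<omega> m"
proof -
  have "upper_factor a (t - walk \<xi>s n \<omega>) (path \<omega> n)
      \<le> ennreal (exp (a * Xs (Suc n) (t + 1 - walk \<xi>s n \<omega>) \<omega>))" for n
    using upper_factor_le[OF copy_mono[OF assms] a_pos, of "t - walk \<xi>s n \<omega>"]
    unfolding path_def by (simp add: algebra_simps)
  then show ?thesis
    unfolding noise_product_eq L.partial_product_def L.factor_def pos_path
    by (induction m) (auto intro!: mult_mono)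
qed

lemma exp_moment_eq:
  "shot_noise_exp_moment M Xs \<xi>s a t = (\<integral>\<^sup>+\<omega>. (SUP m. noise_product t \<omega> m) \<partial>M)"
  unfolding shot_noise_exp_moment_def shot_noise_def noise_product_eq
  using copy_mono(2) a_pos by (intro nn_integral_cong ennexp_suminf) auto

lemma exp_moment_le: "shot_noise_exp_moment M Xs \<xi>s a t \<le> 1 + L.total_excess t"
proof -
  \<comment> \<open>\<open>nn_integral_mono\<close> compares arbitrary integrands, so only the
    majorant has to be measurable for the transfer to path space.\<close>
  have "shot_noise_exp_moment M Xs \<xi>s a t \<le> (\<integral>\<^sup>+\<omega>. L.full_product t (path \<omega>) \<partial>M)"
    unfolding exp_moment_eq L.full_product_def by (intro nn_integral_mono SUP_mono' noise_product_le)
  then show ?thesis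
    by (simp add: nn_integral_path L.full_expectation)
qed

lemma le_exp_moment: "1 + L.total_excess t \<le> shot_noise_exp_moment M Xs \<xi>s a (t + 1)"
proof -
  have "(\<integral>\<^sup>+\<omega>. L.full_product t (path \<omega>) \<partial>M) \<le> shot_noise_exp_moment M Xs \<xi>s a (t + 1)"
    unfolding exp_moment_eq L.full_product_def by (intro nn_integral_mono SUP_mono' le_noise_product)
  then show ?thesis
    by (simp add: nn_integral_path L.full_expectation)
qed

lemma ladder_product_mean_eq:
  "ladder_product_mean M Xs \<xi>s a t = (\<integral>\<^sup>+\<omega>. (case ladder_epoch (L.pos (path \<omega>)) (Suc 0) of
     enat m \<Rightarrow> noise_product t \<omega> m | \<infinity> \<Rightarrow> (SUP m. noise_product t \<omega> m)) \<partial>M)"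
  unfolding ladder_product_mean_def noise_product_def Let_def ladder_epoch_path One_nat_def ..

lemma ladder_mean_le: "ladder_product_mean M Xs \<xi>s a t \<le> 1 + L.ladder_excess t"
proof -
  have "ladder_product_mean M Xs \<xi>s a t \<le> (\<integral>\<^sup>+\<omega>. L.ladder_product t (path \<omega>) \<partial>M)"
    unfolding ladder_product_mean_eq L.ladder_product_def L.full_product_def
  proof (rule nn_integral_mono)
    fix \<omega> assume "\<omega> \<in> space M"
    note le = noise_product_le[OF this, of t]
    show "(case ladder_epoch (L.pos (path \<omega>)) (Suc 0) of
        enat m \<Rightarrow> noise_product t \<omega> m | \<infinity> \<Rightarrow> (SUP m. noise_product t \<omega> m)) \<le> (case ladder_epoch (L.pos (path \<omega>)) (Suc 0) of
        enat m \<Rightarrow> L.partial_product t (path \<omega>) m | \<infinity> \<Rightarrow> (SUP m. L.partial_product t (path \<omega>) m))"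
    proof (cases "ladder_epoch (L.pos (path \<omega>)) (Suc 0)")
      case (enat m)
      show ?thesis
        unfolding enat enat.case by (rule le)
    next
      case infinity
      show ?thesis
        unfolding infinity enat.case by (rule SUP_mono'[OF le])
    qed
  qed
  then show ?thesis
    by (simp add: nn_integral_path L.ladder_expectation)
qed

lemma le_ladder_mean: "1 + L.ladder_excess t \<le> ladder_product_mean M Xs \<xi>s a (t + 1)"
proof -
  have "(\<integral>\<^sup>+\<omega>. L.ladder_product t (path \<omega>) \<partial>M) \<le> ladder_product_mean M Xs \<xi>s a (t + 1)"
    unfolding ladder_product_mean_eq L.ladder_product_def L.full_product_def
  proof (rule nn_integral_mono)
    fix \<omega> assume "\<omega> \<in> space M"
    note le = le_noise_product[OF this, of t]
    show "(case ladder_epoch (L.pos (path \<omega>)) (Suc 0) of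
        enat m \<Rightarrow> L.partial_product t (path \<omega>) m | \<infinity> \<Rightarrow> (SUP m. L.partial_product t (path \<omega>) m)) \<le> (case ladder_epoch (L.pos (path \<omega>)) (Suc 0) of
        enat m \<Rightarrow> noise_product (t + 1) \<omega> m | \<infinity> \<Rightarrow> (SUP m. noise_product (t + 1) \<omega> m))"
    proof (cases "ladder_epoch (L.pos (path \<omega>)) (Suc 0)")
      case (enat m)
      show ?thesis
        unfolding enat enat.case by (rule le)
    next
      case infinity
      show ?thesis
        unfolding infinity enat.case by (rule SUP_mono'[OF le])
    qed
  qed
  then show ?thesis
    by (simp add: nn_integral_path L.ladder_expectation)
qed

section \<open>Integrals against the renewal measures\<close>

lemma measurable_walk [measurable]: "walk \<xi>s n \<in> borel_measurable M"
  unfolding pos_path[symmetric, abs_def] by measurable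

lemma nn_integral_renewal_measure:
  assumes [measurable]: "f \<in> borel_measurable borel"
  shows "(\<integral>\<^sup>+u. f u \<partial>renewal_measure M (walk \<xi>s)) = (\<Sum>n. \<integral>\<^sup>+w. f (L.pos w n) \<partial>path_space)"
proof -
  have "(\<integral>\<^sup>+u. f u \<partial>renewal_measure M (walk \<xi>s)) = (\<Sum>n. \<integral>\<^sup>+\<omega>. f (walk \<xi>s n \<omega>) \<partial>M)"
    unfolding renewal_measure_def
    using nn_integral_sum_of_laws[of M "\<lambda>_ _. True" "walk \<xi>s" f] sigma_finite_measure_axioms by simp
  also have "\<dots> = (\<Sum>n. \<integral>\<^sup>+w. f (L.pos w n) \<partial>path_space)"
    unfolding pos_path[symmetric] by (subst nn_integral_path) auto
  finally show ?thesis .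
qed

lemma nn_integral_ladder_renewal_measure:
  assumes [measurable]: "f \<in> borel_measurable borel"
  shows "(\<integral>\<^sup>+u. f u \<partial>ladder_renewal_measure M (walk \<xi>s)) = (\<Sum>n. \<integral>\<^sup>+w. L.at_ladder n f w \<partial>path_space)"
proof -
  define T where "T n \<omega> = ladder_epoch (L.pos (path \<omega>)) n" for n \<omega>
  define A where "A n \<omega> \<longleftrightarrow> (\<exists>m. T n \<omega> = enat m)" for n \<omega>
  \<comment> \<open>A total function is needed for the general formula; its arbitrary value at an
    infinite epoch is masked by \<open>A n\<close>.\<close>
  define V where "V n \<omega> = walk \<xi>s (LEAST m. T n \<omega> = enat m) \<omega>" for n \<omega>
  have [measurable]: "Measurable.pred M (\<lambda>\<omega>. T n \<omega> = enat m)" for n m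
    unfolding T_def by measurable
  have [measurable]: "Measurable.pred M (A n)" for n
    unfolding A_def by measurable
  have [measurable]: "V n \<in> borel_measurable M" for n
    unfolding V_def by measurable
  have "(\<exists>m. ladder_epoch (\<lambda>k. walk \<xi>s k \<omega>) n = enat m \<and> walk \<xi>s m \<omega> \<in> B) \<longleftrightarrow> A n \<omega> \<and> V n \<omega> \<in> B" for n \<omega> B
    unfolding ladder_epoch_path A_def V_def T_def[symmetric] by (cases "T n \<omega>") (auto simp: Least_equality)
  then have "(\<integral>\<^sup>+u. f u \<partial>ladder_renewal_measure M (walk \<xi>s))
      = (\<Sum>n. \<integral>\<^sup>+\<omega>. (if A n \<omega> then f (V n \<omega>) else 0) \<partial>M)"
    unfolding ladder_renewal_measure_def
    using nn_integral_sum_of_laws[of M A V f] sigma_finite_measure_axioms by simp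
  also have "\<dots> = (\<Sum>n. \<integral>\<^sup>+\<omega>. L.at_ladder n f (path \<omega>) \<partial>M)"
  proof (intro suminf_cong nn_integral_cong)
    show "(if A n \<omega> then f (V n \<omega>) else 0) = L.at_ladder n f (path \<omega>)" for n \<omega>
      unfolding A_def V_def L.at_ladder_def T_def[symmetric]
      by (cases "T n \<omega>") (auto simp: pos_path Least_equality)
  qed
  also have "\<dots> = (\<Sum>n. \<integral>\<^sup>+w. L.at_ladder n f w \<partial>path_space)"
    by (subst nn_integral_path) auto
  finally show ?thesis .
qed

lemma ladder_potential_eq_integral:
  "L.ladder_potential t = (\<integral>\<^sup>+u. L.ladder_excess (t - u) \<partial>ladder_renewal_measure M (walk \<xi>s))"
  unfolding L.ladder_potential_def L.ladder_kernel_def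
  by (subst nn_integral_ladder_renewal_measure) auto

lemma r_ladder_le: "r_ladder M Xs \<xi>s a t \<le> L.ladder_potential t"
  unfolding r_ladder_def ladder_potential_eq_integral
proof (rule nn_integral_mono)
  fix u
  have "ladder_product_mean M Xs \<xi>s a (t - u) - 1 \<le> 1 + L.ladder_excess (t - u) - 1"
    by (intro ennreal_minus_mono ladder_mean_le order_refl)
  then show "ladder_product_mean M Xs \<xi>s a (t - u) - 1 \<le> L.ladder_excess (t - u)"
    by (simp add: ennreal_add_diff_cancel_left)
qed

lemma le_r_ladder: "L.ladder_potential t \<le> r_ladder M Xs \<xi>s a (t + 1)"
  unfolding r_ladder_def ladder_potential_eq_integral
proof (rule nn_integral_mono)
  fix u
  have "1 + L.ladder_excess (t - u) - 1 \<le> ladder_product_mean M Xs \<xi>s a (t - u + 1) - 1"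
    by (intro ennreal_minus_mono le_ladder_mean order_refl)
  then show "L.ladder_excess (t - u) \<le> ladder_product_mean M Xs \<xi>s a (t + 1 - u) - 1"
    by (simp add: ennreal_add_diff_cancel_left algebra_simps)
qed

text \<open>Replace the mean of \<open>exp (a X)\<close> by that of the majorant, which is
  measurable in time, and rewrite the renewal integral as the sum of mean excesses.\<close>

lemma r_walk_le: "r_walk M X \<xi>s a t \<le> L.total_excess t"
proof -
  have le: "(\<integral>\<^sup>+\<omega>. ennreal (exp (a * X s \<omega>)) \<partial>M) \<le> (\<integral>\<^sup>+e. upper_factor a s e \<partial>law)" for s
  proof -
    have "(\<integral>\<^sup>+\<omega>. ennreal (exp (a * X s \<omega>)) \<partial>M) \<le> (\<integral>\<^sup>+\<omega>. upper_factor a s (\<lambda>t. X t \<omega>, \<xi> \<omega>) \<partial>M)"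
      using process a_pos
      by (intro nn_integral_mono le_upper_factor) (auto simp: nonneg_nondecreasing_process_def)
    also have "\<dots> = (\<integral>\<^sup>+e. upper_factor a s e \<partial>law)"
      unfolding law_def
      by (subst nn_integral_distr) simp_all
    finally show ?thesis .
  qed
  have "r_walk M X \<xi>s a t \<le> (\<integral>\<^sup>+y. ((\<integral>\<^sup>+e. upper_factor a (t - y) e \<partial>law) - 1) \<partial>renewal_measure M (walk \<xi>s))"
    unfolding r_walk_def by (intro nn_integral_mono ennreal_minus_mono le order_refl)
  also have "\<dots> = (\<Sum>n. \<integral>\<^sup>+w. (\<integral>\<^sup>+e. upper_factor a (t - L.pos w n) e \<partial>law) - 1 \<partial>path_space)"
    by (intro nn_integral_renewal_measure) measurable
  also have "\<dots> \<le> L.total_excess t"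
    by (rule L.mean_excess_sum_le_total_excess)
  finally show ?thesis .
qed

section \<open>Equivalence of the finiteness conditions\<close>

text \<open>The times \<open>s\<close> and \<open>t\<close> are unrelated: finiteness of the total
  excess spreads to all times, which absorbs the unit shift of the comparison.\<close>

lemma exp_moment_finite_iff:
  "(shot_noise_exp_moment M Xs \<xi>s a t < \<infinity>) \<longleftrightarrow> L.total_excess s < \<infinity>"
proof
  assume "shot_noise_exp_moment M Xs \<xi>s a t < \<infinity>"
  then have "1 + L.total_excess (t - 1) < \<infinity>"
    by (rule le_less_trans[OF le_exp_moment[of "t - 1", simplified]])
  then have "L.total_excess (t - 1) < \<infinity>"
    by simp
  then show "L.total_excess s < \<infinity>"
    by (rule L.total_excess_finite_everywhere)
next
  assume "L.total_excess s < \<infinity>"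
  then have "1 + L.total_excess t < \<infinity>"
    using L.total_excess_finite_everywhere[of s t] by simp
  then show "shot_noise_exp_moment M Xs \<xi>s a t < \<infinity>"
    by (rule le_less_trans[OF exp_moment_le])
qed

lemma r_ladder_finite_iff:
  "r_ladder M Xs \<xi>s a t < \<infinity> \<longleftrightarrow> L.ladder_potential s < \<infinity>"
proof
  assume "r_ladder M Xs \<xi>s a t < \<infinity>"
  then have "L.ladder_potential (t - 1) < \<infinity>"
    using le_r_ladder[of "t - 1"] by (auto intro: le_less_trans)
  then show "L.ladder_potential s < \<infinity>"
    by (rule L.ladder_potential_finite_everywhere)
next
  assume "L.ladder_potential s < \<infinity>"
  then show "r_ladder M Xs \<xi>s a t < \<infinity>"
    by (rule le_less_trans[OF r_ladder_le L.ladder_potential_finite_everywhere])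
qed

text \<open>A finite potential is below 1 far to the left, where the total excess is then finite,
  and this spreads everywhere. The converse is the minimality bound.\<close>

lemma ladder_potential_finite_iff:
  "L.ladder_potential s < \<infinity> \<longleftrightarrow> L.total_excess s < \<infinity>"
proof
  assume "L.ladder_potential s < \<infinity>"
  then obtain t where "L.total_excess t < \<infinity>"
    using L.ladder_potential_finite_everywhere L.total_excess_finite_somewhere by blast
  then show "L.total_excess s < \<infinity>"
    by (rule L.total_excess_finite_everywhere)
qed (rule le_less_trans[OF L.ladder_potential_le_total_excess])

lemma consequences_of_finiteness:
  assumes "L.total_excess s < \<infinity>"
  shows "r_walk M X \<xi>s a t < \<infinity>" "ladder_product_mean M Xs \<xi>s a t < \<infinity>"
proof -
  have fin: "L.total_excess t < \<infinity>"
    using assms by (rule L.total_excess_finite_everywhere)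
  then show "r_walk M X \<xi>s a t < \<infinity>"
    by (rule le_less_trans[OF r_walk_le])
  have "L.ladder_excess t < \<infinity>"
    using fin by (intro le_less_trans[OF order_trans[OF L.ladder_excess_le_potential
      L.ladder_potential_le_total_excess]])
  then have "1 + L.ladder_excess t < \<infinity>"
    by simp
  then show "ladder_product_mean M Xs \<xi>s a t < \<infinity>"
    by (rule le_less_trans[OF ladder_mean_le])
qed

end

theorem theorem3p6:
  fixes M :: "'w measure"
    and X :: "real \<Rightarrow> 'w \<Rightarrow> real" and \<xi> :: "'w \<Rightarrow> real"
    and Xs :: "nat \<Rightarrow> real \<Rightarrow> 'w \<Rightarrow> real" and \<xi>s :: "nat \<Rightarrow> 'w \<Rightarrow> real"
    and a :: real
  assumes "prob_space M"
    and "\<xi> \<in> borel_measurable M"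
    and "measure M {\<omega>\<in>space M. \<xi> \<omega> = 0} < 1"
    and "nonneg_nondecreasing_process M X"
    and "AE \<omega> in M. ((\<lambda>t. X t \<omega>) \<longlongrightarrow> 0) at_bot"
    and "independent_copies M X \<xi> Xs \<xi>s"
    and "positively_divergent M (walk \<xi>s)"
    and "measure M {\<omega>\<in>space M. \<xi> \<omega> < 0} > 0"
    and "a > 0"
  shows "((\<exists>t. shot_noise_exp_moment M Xs \<xi>s a t < \<infinity>) \<longleftrightarrow> (\<forall>t. shot_noise_exp_moment M Xs \<xi>s a t < \<infinity>)) \<and>
         ((\<forall>t. shot_noise_exp_moment M Xs \<xi>s a t < \<infinity>) \<longleftrightarrow> (\<forall>t. r_ladder M Xs \<xi>s a t < \<infinity>)) \<and>
         ((\<forall>t. r_ladder M Xs \<xi>s a t < \<infinity>) \<longleftrightarrow> (\<exists>t. r_ladder M Xs \<xi>s a t < \<infinity>)) \<and>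
         ((\<exists>t. shot_noise_exp_moment M Xs \<xi>s a t < \<infinity>) \<longrightarrow>
            (\<forall>t. r_walk M X \<xi>s a t < \<infinity>) \<and> (\<forall>t. ladder_product_mean M Xs \<xi>s a t < \<infinity>))"
proof -
  interpret renewal_shot_noise M X \<xi> Xs \<xi>s a
    using assms by (simp add: renewal_shot_noise_def renewal_shot_noise_axioms_def)
  \<comment> \<open>Fixing the reference time 0 rewrites all four assertions to the single statement
    that the total excess at 0 is finite.\<close>
  note equivalences = exp_moment_finite_iff[of _ 0] r_ladder_finite_iff[of _ 0] ladder_potential_finite_iff[of 0]
  show ?thesis
    unfolding equivalences using consequences_of_finiteness[of 0] by blast
qed

end
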